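(* Let $G=(V,E)$ be a graph, let $h,k,\alpha,\beta\in\mathbb{Z}_{>0}$, and let $\ell,\ell':\{1,\dots,k\}\to\mathbb{Z}_{>0}$ be such that $$\sum_{i=1}^k\ell'(i)\ \ge\ \beta\ \ge\ \alpha\ \ge\ \sum_{i=1}^k\ell(i),\qquad |V|\ge \ell'(i)\ge \ell(i)\ \text{ for every } 1\le i\le k.$$ There exists an $h$-regular $(\ell,\ell')$-bordered $(\alpha,\beta)$-limited packing of $k$ forests in $G$ if and only if all of the following hold: $$h|V|\ge\alpha,$$ $$\beta-\sum_{i=1}^k\ell(i)+\sum_{i=1}^k\min\{\ell(i),|\mathcal{P}|\}+e_{E}(\mathcal{P})\ \ge\ h|\mathcal{P}|\quad\text{for every partition }\mathcal{P}\text{ of }V,$$ $$\sum_{i=1}^k\min\{\ell'(i),|\mathcal{P}|\}+e_{E}(\mathcal{P})\ \ge\ h|\mathcal{P}|\quad\text{for every partition }\mathcal{P}\text{ of }V.$$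
   Context: Graphs are finite and undirected with nonempty vertex set; parallel edges are allowed. For a partition $\mathcal{P}$ of $V$, $e_E(\mathcal{P})$ is the number of edges in $E$ that enter some member of $\mathcal{P}$, i.e. whose end-vertices lie in two different members of $\mathcal{P}$. A packing of $k$ forests in $G$ is a collection $F_1,\dots,F_k$ of pairwise edge-disjoint subgraphs of $G$, each of which is a forest (not necessarily spanning; isolated vertices are allowed, and each counts as a connected component). It is $h$-regular if every vertex of $G$ belongs to exactly $h$ of the forests. Writing $c(F_i)$ for the number of connected components of $F_i$ (which is the number of roots when $F_i$ is viewed as a rooted forest with one root in each component), the packing is $(\ell,\ell')$-bordered if $\ell(i)\le c(F_i)\le\ell'(i)$ for every $1\le i\le k$, and $(\alpha,\beta)$-limited if $\alpha\le\sum_{i=1}^k c(F_i)\le\beta$. *)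

theory Defs
  imports Main "HOL-Library.Disjoint_Sets"
begin

record ('v, 'e) ugraph =
  verts :: "'v set"
  edges :: "'e set"
  ends :: "'e \<Rightarrow> 'v set"

text \<open>
  Edges are abstract objects carrying a set of end-vertices, so parallel edges are different
  edges with the same \<open>ends\<close>. A singleton \<open>ends\<close> is a loop. Loops are harmless here: they lie
  in no forest and never join two members of a partition.
\<close>
definition graph :: "('v, 'e) ugraph \<Rightarrow> bool" where
  "graph G \<longleftrightarrow> finite (verts G) \<and> verts G \<noteq> {} \<and> finite (edges G) \<and>
     (\<forall>e\<in>edges G. ends G e \<subseteq> verts G \<and> card (ends G e) \<in> {1, 2})"

definition subgraph :: "('v, 'e) ugraph \<Rightarrow> ('v, 'e) ugraph \<Rightarrow> bool" where
  "subgraph F G \<longleftrightarrow> graph F \<and> graph G \<and> verts F \<subseteq> verts G \<and> edges F \<subseteq> edges G \<and>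
     (\<forall>e\<in>edges F. ends F e = ends G e)"

text \<open>
  A cycle of length 1 is a loop, one of length 2 is a pair of parallel edges.
\<close>
definition is_cycle :: "('v, 'e) ugraph \<Rightarrow> 'v list \<Rightarrow> 'e list \<Rightarrow> bool" where
  "is_cycle G vs es \<longleftrightarrow> vs \<noteq> [] \<and> length es = length vs \<and> distinct vs \<and> distinct es \<and>
     set vs \<subseteq> verts G \<and> set es \<subseteq> edges G \<and>
     (\<forall>i<length vs. ends G (es ! i) = {vs ! i, vs ! (Suc i mod length vs)})"

definition forest :: "('v, 'e) ugraph \<Rightarrow> bool" where
  "forest G \<longleftrightarrow> graph G \<and> (\<nexists>vs es. is_cycle G vs es)"

definition adj :: "('v, 'e) ugraph \<Rightarrow> 'v rel" where
  "adj G = {(u, v). \<exists>e\<in>edges G. ends G e = {u, v}}"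

definition components :: "('v, 'e) ugraph \<Rightarrow> 'v set set" where
  "components G = verts G // (adj G)\<^sup>*"

definition num_components :: "('v, 'e) ugraph \<Rightarrow> nat" where
  "num_components G = card (components G)"

definition cross_edges :: "('v, 'e) ugraph \<Rightarrow> 'v set set \<Rightarrow> nat" where
  "cross_edges G P =
     card {e \<in> edges G. \<exists>X\<in>P. \<exists>Y\<in>P. X \<noteq> Y \<and> ends G e \<inter> X \<noteq> {} \<and> ends G e \<inter> Y \<noteq> {}}"

definition forest_packing :: "('v, 'e) ugraph \<Rightarrow> nat \<Rightarrow> (nat \<Rightarrow> ('v, 'e) ugraph) \<Rightarrow> bool" where
  "forest_packing G k F \<longleftrightarrow>
     (\<forall>i\<in>{1..k}. subgraph (F i) G \<and> forest (F i)) \<and>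
     (\<forall>i\<in>{1..k}. \<forall>j\<in>{1..k}. i \<noteq> j \<longrightarrow> edges (F i) \<inter> edges (F j) = {})"

definition regular_packing ::
    "nat \<Rightarrow> ('v, 'e) ugraph \<Rightarrow> nat \<Rightarrow> (nat \<Rightarrow> ('v, 'e) ugraph) \<Rightarrow> bool" where
  "regular_packing h G k F \<longleftrightarrow> (\<forall>v\<in>verts G. card {i \<in> {1..k}. v \<in> verts (F i)} = h)"

definition bordered_packing ::
    "(nat \<Rightarrow> nat) \<Rightarrow> (nat \<Rightarrow> nat) \<Rightarrow> nat \<Rightarrow> (nat \<Rightarrow> ('v, 'e) ugraph) \<Rightarrow> bool" where
  "bordered_packing l l' k F \<longleftrightarrow>
     (\<forall>i\<in>{1..k}. l i \<le> num_components (F i) \<and> num_components (F i) \<le> l' i)"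

definition limited_packing ::
    "nat \<Rightarrow> nat \<Rightarrow> nat \<Rightarrow> (nat \<Rightarrow> ('v, 'e) ugraph) \<Rightarrow> bool" where
  "limited_packing \<alpha> \<beta> k F \<longleftrightarrow>
     \<alpha> \<le> (\<Sum>i=1..k. num_components (F i)) \<and> (\<Sum>i=1..k. num_components (F i)) \<le> \<beta>"

end

theory Submission
  imports Defs
begin

text \<open>
Call the index \<open>i\<close> of a forest a colour. Necessity is a count (\<open>packing_covers_partition\<close>): if a
forest with \<open>c\<close> components meets \<open>q\<close> members of \<open>\<P>\<close>, at least \<open>q - c\<close> of its edges cross \<open>\<P>\<close>,
because deleting an edge creates at most one new component; every member is met by at least \<open>h\<close>
forests.

For sufficiency, the component numbers \<open>t i\<close> are fixed in advance, with sum
\<open>min \<beta> (h * card V)\<close> and as equal as the bounds permit (\<open>ex_balanced\<close>). Then for each \<open>p\<close> the sum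
of the \<open>min (t i) p\<close> is at least the sum of the \<open>min (\<ell>' i) p\<close>, or at least the total number of
components minus the sum of the \<open>\<ell> i\<close> plus the sum of the \<open>min (\<ell> i) p\<close> (\<open>balanced_min_sum\<close>), so
the two partition conditions merge into
\<open>h * card P \<le> (\<Sum>i. min (t i) (card P)) + e(P)\<close>.
It remains to find forests with exactly \<open>t i\<close> components, in two stages that share one invariant.
Let \<open>R v\<close> be the set of colours already present at \<open>v\<close>. The invariant \<open>feasible\<close> says that every
partition is crossed by at least as many unused edges as its members lack colours, where a member
lacks \<open>h\<close> minus the number of colours present in it.

First the roots are placed, one colour at a time (\<open>place_colour\<close>). While some colours are still to
be placed, the condition quantifies over the subsets \<open>L\<close> of these as well: the colours in \<open>L\<close> are
available everywhere for free, the others cost \<open>t i\<close> each. A smallest admissible root set is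
isolated element by element by tight pairs \<open>(P, L)\<close>, and uncrossing merges these into a single
tight pair that bounds its size by \<open>t i\<close>. A few exchanges then make the root numbers exact
(\<open>ex_roots\<close>).

Then the forests grow from the roots (\<open>extend_along_edge\<close>): while a vertex has fewer than \<open>h\<close>
colours, there are an edge \<open>uv\<close> and a colour of \<open>u\<close> missing at \<open>v\<close> such that giving this colour to
\<open>v\<close> and spending the edge preserves the invariant. Each such step attaches a leaf to a forest, so
no cycle arises and the number of components does not change (\<open>grow_forests\<close>). The growing step
is an undirected version of the Lovasz-style induction for matroid-based packings of arborescences.

Both stages rest on \<open>uncross_need\<close>: the total lack of colours is supermodular on the lattice of
partitions, while the number of crossing edges is submodular.
\<close>

section \<open>Uncrossing partitions\<close>

text \<open>
The truncated subtraction is intended: it makes \<open>need\<close> a nonnegative function, and both its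
monotonicity and its nonnegativity are used when two partitions are uncrossed.
\<close>
definition need :: "nat \<Rightarrow> ('v \<Rightarrow> 'c set) \<Rightarrow> 'v set \<Rightarrow> nat" where
  "need h R X = h - card (\<Union>(R ` X))"

definition total_need :: "nat \<Rightarrow> ('v \<Rightarrow> 'c set) \<Rightarrow> 'v set set \<Rightarrow> nat" where
  "total_need h R P = (\<Sum>X\<in>P. need h R X)"

definition crossing :: "('e \<Rightarrow> 'v set) \<Rightarrow> 'v set set \<Rightarrow> 'e \<Rightarrow> bool" where
  "crossing d P e \<longleftrightarrow> (\<exists>X\<in>P. \<exists>Y\<in>P. X \<noteq> Y \<and> d e \<inter> X \<noteq> {} \<and> d e \<inter> Y \<noteq> {})"

text \<open>
The edge set is a separate argument because edges are used up while the forests grow.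
\<close>
definition cut_size :: "('e \<Rightarrow> 'v set) \<Rightarrow> 'e set \<Rightarrow> 'v set set \<Rightarrow> nat" where
  "cut_size d E P = card {e \<in> E. crossing d P e}"

definition meet :: "'v set set \<Rightarrow> 'v set set \<Rightarrow> 'v set set" where
  "meet P Q = (\<lambda>(X, Y). X \<inter> Y) ` (P \<times> Q) - {{}}"

text \<open>
Truncation at \<open>h\<close> preserves supermodularity because \<open>C\<close> is contained in both \<open>A\<close> and \<open>B\<close>, so its
term is truncated only when theirs are.
\<close>
lemma truncated_card_supermodular:
  fixes h :: nat
  assumes "finite A" "finite B" "C \<subseteq> A \<inter> B" "D \<subseteq> A \<union> B"
  shows "(h - card A) + (h - card B) \<le> (h - card C) + (h - card D)"
proof -
  have "card C \<le> card (A \<inter> B)" "card D \<le> card (A \<union> B)"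
    using assms by (auto intro: card_mono)
  moreover have "card (A \<union> B) + card (A \<inter> B) = card A + card B"
    using card_Un_Int[OF assms(1,2)] by simp
  moreover have "card (A \<inter> B) \<le> card A" "card (A \<inter> B) \<le> card B"
    using assms by (auto intro: card_mono)
  ultimately show ?thesis by arith
qed

lemma finite_colours: "finite (\<Union>(range R)) \<Longrightarrow> finite (\<Union>(R ` X))"
  by (rule finite_subset[rotated]) auto

lemma finite_colours_Un:
  assumes "finite (\<Union>(range R))" "finite L"
  shows "finite (\<Union>(range (\<lambda>v. R v \<union> L)))"
  by (rule finite_subset[of _ "\<Union>(range R) \<union> L"]) (use assms in auto)

lemma need_antimono:
  assumes "finite (\<Union>(range R))" "X \<subseteq> Y"
  shows "need h R Y \<le> need h R X"
  unfolding need_def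
  by (rule diff_le_mono2, rule card_mono) (use assms finite_colours in auto)

lemma need_supermodular:
  assumes "finite (\<Union>(range R))"
  shows "need h R X + need h R Y \<le> need h R (X \<inter> Y) + need h R (X \<union> Y)"
  unfolding need_def
  by (rule truncated_card_supermodular) (use assms finite_colours in auto)

lemma in_same_part:
  "partition_on V P \<Longrightarrow> X \<in> P \<Longrightarrow> Y \<in> P \<Longrightarrow> x \<in> X \<Longrightarrow> x \<in> Y \<Longrightarrow> X = Y"
  by (auto simp: partition_on_def disjoint_def)

lemma partition_on_meet:
  assumes "partition_on V P" "partition_on V Q"
  shows "partition_on V (meet P Q)"
proof (rule partition_onI)
  have "\<Union>(meet P Q) = \<Union>P \<inter> \<Union>Q" by (auto simp: meet_def)
  then show "\<Union>(meet P Q) = V"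
    using partition_onD1[OF assms(1)] partition_onD1[OF assms(2)] by simp
next
  fix p q assume "p \<in> meet P Q" "q \<in> meet P Q" "p \<noteq> q"
  then obtain X Y X' Y' where *: "X \<in> P" "Y \<in> Q" "X' \<in> P" "Y' \<in> Q"
    "p = X \<inter> Y" "q = X' \<inter> Y'" by (auto simp: meet_def)
  have False if "x \<in> p" "x \<in> q" for x
    using in_same_part[OF assms(1) *(1,3), of x] in_same_part[OF assms(2) *(2,4), of x]
      * that \<open>p \<noteq> q\<close> by auto
  then show "disjnt p q" by (auto simp: disjnt_def)
qed (auto simp: meet_def)

lemma refines_meet:
  assumes "partition_on V P" "partition_on V Q"
  shows "refines V (meet P Q) P" "refines V (meet P Q) Q"
  using assms partition_on_meet[OF assms] by (auto simp: refines_def meet_def)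

lemma total_need_meet:
  assumes P: "partition_on V P" and Q: "partition_on V Q" and V: "finite V"
  shows "total_need h R (meet P Q) = (\<Sum>X\<in>P. \<Sum>Y\<in>{Y\<in>Q. X \<inter> Y \<noteq> {}}. need h R (X \<inter> Y))"
proof -
  let ?S = "SIGMA X:P. {Y\<in>Q. X \<inter> Y \<noteq> {}}"
  have fin: "finite P" "finite Q" using V P Q finite_elements by auto
  have eq: "meet P Q = (\<lambda>(X, Y). X \<inter> Y) ` ?S" by (auto simp: meet_def)
  have inj: "inj_on (\<lambda>(X, Y). X \<inter> Y) ?S"
    using in_same_part[OF P] in_same_part[OF Q] by (fastforce simp: inj_on_def)
  have "total_need h R (meet P Q) = (\<Sum>(X, Y)\<in>?S. need h R (X \<inter> Y))"
    unfolding total_need_def eq by (subst sum.reindex[OF inj]) (auto intro: sum.cong)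
  also have "\<dots> = (\<Sum>X\<in>P. \<Sum>Y\<in>{Y\<in>Q. X \<inter> Y \<noteq> {}}. need h R (X \<inter> Y))"
    using fin by (subst sum.Sigma) auto
  finally show ?thesis .
qed

text \<open>
One application of supermodularity per member of \<open>F\<close>. Disjointness of \<open>F\<close> ensures that the part of
the next \<open>Y\<close> met by the union built so far is only \<open>X \<inter> Y\<close>.
\<close>
lemma need_absorb:
  assumes R: "finite (\<Union>(range R))" and "finite F" "disjoint F"
  shows "need h R X + (\<Sum>Y\<in>F. need h R Y) \<le> need h R (X \<union> \<Union>F) + (\<Sum>Y\<in>F. need h R (X \<inter> Y))"
  using assms(2,3)
proof (induction F rule: finite_induct)
  case (insert Y F)
  have "(X \<union> \<Union>F) \<inter> Y = X \<inter> Y"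
    using insert.prems insert.hyps(2) by (auto simp: disjoint_def)
  moreover have "X \<union> \<Union>F \<union> Y = X \<union> \<Union>(insert Y F)" by auto
  ultimately have "need h R (X \<union> \<Union>F) + need h R Y \<le> need h R (X \<inter> Y) + need h R (X \<union> \<Union>(insert Y F))"
    using need_supermodular[OF R, of h "X \<union> \<Union>F" Y] by simp
  moreover have "disjoint F" using insert.prems by (auto simp: disjoint_def)
  ultimately show ?case using insert.IH insert.hyps by simp
qed simp

text \<open>
The witness merges all members of \<open>Q\<close> that meet \<open>X\<close>.
\<close>
lemma uncross_one:
  assumes R: "finite (\<Union>(range R))" and V: "finite V" and Q: "partition_on V Q"
    and X: "X \<subseteq> V" "X \<noteq> {}"
  shows "\<exists>J. refines V Q J \<and> (\<exists>Z\<in>J. X \<subseteq> Z) \<and>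
    need h R X + total_need h R Q \<le>
      total_need h R J + (\<Sum>Y\<in>{Y\<in>Q. X \<inter> Y \<noteq> {}}. need h R (X \<inter> Y))"
proof -
  define F where "F = {Y\<in>Q. X \<inter> Y \<noteq> {}}"
  define J where "J = insert (\<Union>F) (Q - F)"
  have fin: "finite Q" using V Q finite_elements by auto
  have X': "X \<subseteq> \<Union>F" using X partition_onD1[OF Q] by (auto simp: F_def)
  have J: "partition_on V J"
  proof (rule partition_onI)
    show "\<Union>J = V" using partition_onD1[OF Q] by (auto simp: J_def F_def)
    show "{} \<notin> J"
      using X X' partition_onD3[OF Q] by (auto simp: J_def)
    have "disjoint J"
      using partition_onD2[OF Q] unfolding J_def F_def disjoint_def by blast
    then show "disjnt p q" if "p \<in> J" "q \<in> J" "p \<noteq> q" for p q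
      using that by (auto simp: disjoint_def disjnt_def)
  qed
  have notin: "\<Union>F \<notin> Q - F"
  proof
    assume *: "\<Union>F \<in> Q - F"
    then have "X \<inter> \<Union>F = {}" unfolding F_def by blast
    then show False using X X' by blast
  qed
  have "refines V Q J" using J Q by (auto simp: refines_def J_def)
  moreover have "\<exists>Z\<in>J. X \<subseteq> Z" using X' by (auto simp: J_def)
  moreover have "disjoint F"
    using partition_onD2[OF Q] by (auto simp: F_def disjoint_def)
  then have "need h R X + (\<Sum>Y\<in>F. need h R Y) \<le> need h R (X \<union> \<Union>F) + (\<Sum>Y\<in>F. need h R (X \<inter> Y))"
    using need_absorb[OF R] fin by (simp add: F_def)
  moreover have "X \<union> \<Union>F = \<Union>F" using X' by auto
  moreover have "total_need h R J = need h R (\<Union>F) + (\<Sum>Y\<in>Q-F. need h R Y)"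
    unfolding total_need_def J_def using fin notin by simp
  moreover have "total_need h R Q = (\<Sum>Y\<in>F. need h R Y) + (\<Sum>Y\<in>Q-F. need h R Y)"
    unfolding total_need_def using fin
    by (metis (no_types, lifting) F_def add.commute mem_Collect_eq subsetI sum.subset_diff)
  ultimately show ?thesis unfolding F_def by (intro exI[of _ J]) simp
qed

text \<open>
Each member of \<open>J\<close> that meets \<open>X\<close> contains a member of \<open>Q\<close> that meets \<open>X\<close>; the latter has the larger
need since \<open>need\<close> is antitone, and the remaining members of \<open>Q\<close> contribute nonnegative terms. This
compensates for the fact that the meet of two partitions may have more members than an uncrossing
member by member would produce.
\<close>
lemma refines_sum_meeting:
  assumes R: "finite (\<Union>(range R))" and V: "finite V" and J: "refines V Q J"
  shows "(\<Sum>Y\<in>{Y\<in>J. X \<inter> Y \<noteq> {}}. need h R (X \<inter> Y))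
       \<le> (\<Sum>Y\<in>{Y\<in>Q. X \<inter> Y \<noteq> {}}. need h R (X \<inter> Y))"
proof -
  have part: "partition_on V Q" "partition_on V J" using J by (auto simp: refines_def)
  have fin: "finite Q" "finite J" using V part finite_elements by auto
  have "\<exists>Y'\<in>Q. Y' \<subseteq> Y \<and> X \<inter> Y' \<noteq> {}" if Y: "Y \<in> J" "X \<inter> Y \<noteq> {}" for Y
  proof -
    from Y obtain x where x: "x \<in> X" "x \<in> Y" by auto
    with Y part have "x \<in> \<Union>Q" by (auto simp: partition_on_def)
    then obtain Y' where Y': "Y' \<in> Q" "x \<in> Y'" by auto
    then obtain Y'' where "Y'' \<in> J" "Y' \<subseteq> Y''" using J by (auto simp: refines_def)
    then have "Y'' = Y" using in_same_part[OF part(2)] x Y' Y by blast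
    then show ?thesis using x Y' \<open>Y' \<subseteq> Y''\<close> by blast
  qed
  then obtain g where g: "\<And>Y. Y \<in> J \<Longrightarrow> X \<inter> Y \<noteq> {} \<Longrightarrow> g Y \<in> Q \<and> g Y \<subseteq> Y \<and> X \<inter> g Y \<noteq> {}"
    by metis
  show ?thesis
  proof (rule sum_le_included[where i = "\<lambda>Y'. THE Y. Y \<in> J \<and> Y' \<subseteq> Y"])
    show "\<forall>Y\<in>{Y\<in>J. X \<inter> Y \<noteq> {}}. \<exists>Y'\<in>{Y\<in>Q. X \<inter> Y \<noteq> {}}. (THE Y. Y \<in> J \<and> Y' \<subseteq> Y) = Y \<and>
        need h R (X \<inter> Y) \<le> need h R (X \<inter> Y')"
    proof
      fix Y assume "Y \<in> {Y\<in>J. X \<inter> Y \<noteq> {}}"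
      then have Y: "Y \<in> J" "g Y \<in> Q" "g Y \<subseteq> Y" "X \<inter> g Y \<noteq> {}" using g by auto
      have "(THE Z. Z \<in> J \<and> g Y \<subseteq> Z) = Y"
        by (rule the_equality) (use Y in_same_part[OF part(2)] in blast)+
      then show "\<exists>Y'\<in>{Y\<in>Q. X \<inter> Y \<noteq> {}}. (THE Y. Y \<in> J \<and> Y' \<subseteq> Y) = Y \<and>
        need h R (X \<inter> Y) \<le> need h R (X \<inter> Y')"
        using Y need_antimono[OF R, of "X \<inter> g Y" "X \<inter> Y" h] by (intro bexI[of _ "g Y"]) auto
    qed
  qed (use fin in auto)
qed

text \<open>
The members of \<open>P\<close> are absorbed into \<open>Q\<close> one after the other. The partition \<open>J\<close> obtained in the end
is coarser than both, so every edge that crosses \<open>J\<close> crosses \<open>P\<close> as well as \<open>Q\<close>; this is the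
property that the count of crossing edges relies on.
\<close>
lemma uncross_need:
  assumes R: "finite (\<Union>(range R))" and V: "finite V"
    and P: "partition_on V P" and Q: "partition_on V Q"
  shows "\<exists>J. refines V P J \<and> refines V Q J \<and>
    total_need h R P + total_need h R Q \<le> total_need h R (meet P Q) + total_need h R J"
proof -
  have "finite P" using V P finite_elements by auto
  then have "\<exists>J. refines V Q J \<and> (\<forall>X\<in>P. \<exists>Z\<in>J. X \<subseteq> Z) \<and>
    total_need h R P + total_need h R Q \<le>
      total_need h R J + (\<Sum>X\<in>P. \<Sum>Y\<in>{Y\<in>Q. X \<inter> Y \<noteq> {}}. need h R (X \<inter> Y))"
    using order_refl[of P]
  proof (induction rule: finite_subset_induct')
    case empty
    then show ?case using refines_refl[OF Q] by (auto simp: total_need_def)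
  next
    case (insert X P')
    then obtain J where J: "refines V Q J" "\<forall>X\<in>P'. \<exists>Z\<in>J. X \<subseteq> Z"
      "total_need h R P' + total_need h R Q \<le>
        total_need h R J + (\<Sum>X\<in>P'. \<Sum>Y\<in>{Y\<in>Q. X \<inter> Y \<noteq> {}}. need h R (X \<inter> Y))" by auto
    have "X \<subseteq> V" "X \<noteq> {}" using P insert.hyps by (auto simp: partition_on_def)
    moreover have "partition_on V J" using J by (simp add: refines_def)
    ultimately obtain J' where J': "refines V J J'" "\<exists>Z\<in>J'. X \<subseteq> Z"
      "need h R X + total_need h R J \<le>
        total_need h R J' + (\<Sum>Y\<in>{Y\<in>J. X \<inter> Y \<noteq> {}}. need h R (X \<inter> Y))"
      using uncross_one[OF R V] by meson
    have "refines V Q J'" using refines_trans J(1) J'(1) by blast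
    moreover have "\<forall>X\<in>insert X P'. \<exists>Z\<in>J'. X \<subseteq> Z"
    proof
      fix W assume "W \<in> insert X P'"
      then consider "W = X" | "W \<in> P'" by auto
      then show "\<exists>Z\<in>J'. W \<subseteq> Z"
      proof cases
        case 2
        then obtain Z where "Z \<in> J" "W \<subseteq> Z" using J(2) by auto
        moreover then obtain Z' where "Z' \<in> J'" "Z \<subseteq> Z'" using J'(1) by (auto simp: refines_def)
        ultimately show ?thesis by blast
      qed (use J'(2) in simp)
    qed
    moreover have "total_need h R (insert X P') = need h R X + total_need h R P'"
      using insert.hyps by (simp add: total_need_def)
    ultimately show ?case
      using J(3) J'(3) refines_sum_meeting[OF R V J(1), where X = X and h = h] insert.hyps
      by (intro exI[of _ J']) auto
  qed
  then show ?thesis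
    using P by (auto simp: total_need_meet[OF P Q V] refines_def add.commute)
qed

lemma refines_crossing:
  assumes "refines V P J" "crossing d J e" "d e \<subseteq> V"
  shows "crossing d P e"
proof -
  from assms(2) obtain X Y x y where *: "X \<in> J" "Y \<in> J" "X \<noteq> Y" "x \<in> d e" "x \<in> X" "y \<in> d e" "y \<in> Y"
    by (auto simp: crossing_def)
  have part: "partition_on V P" "partition_on V J" using assms by (auto simp: refines_def)
  have "x \<in> \<Union>P" "y \<in> \<Union>P" using * assms(3) partition_onD1[OF part(1)] by auto
  then obtain X' Y' where 1: "X' \<in> P" "Y' \<in> P" "x \<in> X'" "y \<in> Y'" by blast
  obtain X'' Y'' where "X'' \<in> J" "X' \<subseteq> X''" "Y'' \<in> J" "Y' \<subseteq> Y''"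
    using assms(1) 1 unfolding refines_def by meson
  then have "X'' = X" "Y' \<subseteq> Y" using in_same_part[OF part(2)] 1 * by blast+
  then have "X' \<noteq> Y'"
    using 1 * \<open>X' \<subseteq> X''\<close> in_same_part[OF part(2)] by blast
  then show ?thesis using 1 * by (auto simp: crossing_def)
qed

lemma crossing_meet:
  assumes "partition_on V P" "partition_on V Q" "crossing d (meet P Q) e"
  shows "crossing d P e \<or> crossing d Q e"
proof -
  from assms(3) obtain Z Z' where Z: "Z \<in> meet P Q" "Z' \<in> meet P Q" "Z \<noteq> Z'"
    "d e \<inter> Z \<noteq> {}" "d e \<inter> Z' \<noteq> {}"
    unfolding crossing_def by blast
  from Z(1,2) obtain X Y X' Y' where "X \<in> P" "Y \<in> Q" "X' \<in> P" "Y' \<in> Q" "Z = X \<inter> Y" "Z' = X' \<inter> Y'"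
    unfolding meet_def by auto
  with Z have *: "X \<in> P" "Y \<in> Q" "X' \<in> P" "Y' \<in> Q" "X \<inter> Y \<noteq> X' \<inter> Y'"
    "d e \<inter> (X \<inter> Y) \<noteq> {}" "d e \<inter> (X' \<inter> Y') \<noteq> {}" by auto
  then have "X \<noteq> X' \<or> Y \<noteq> Y'" by auto
  then show ?thesis using * unfolding crossing_def by blast
qed

lemma uncross_cut:
  assumes E: "finite E" and ends: "\<forall>e\<in>E. d e \<subseteq> V"
    and P: "refines V P J" and Q: "refines V Q J"
  shows "cut_size d E (meet P Q) + cut_size d E J \<le> cut_size d E P + cut_size d E Q"
proof -
  let ?c = "\<lambda>P. {e \<in> E. crossing d P e}"
  have part: "partition_on V P" "partition_on V Q" using P Q by (auto simp: refines_def)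
  have "?c (meet P Q) \<subseteq> ?c P \<union> ?c Q" using crossing_meet[OF part, of d] by (auto simp del: One_nat_def)
  moreover have "?c J \<subseteq> ?c P \<inter> ?c Q"
    using refines_crossing[OF P, of d] refines_crossing[OF Q, of d] ends by auto
  ultimately have "card (?c (meet P Q)) \<le> card (?c P \<union> ?c Q)" "card (?c J) \<le> card (?c P \<inter> ?c Q)"
    using E by (auto intro!: card_mono)
  moreover have "card (?c P \<union> ?c Q) + card (?c P \<inter> ?c Q) = card (?c P) + card (?c Q)"
    using E by (intro card_Un_Int[symmetric]) auto
  ultimately show ?thesis unfolding cut_size_def by linarith
qed

section \<open>Extending the colours along an edge\<close>

definition feasible ::
    "nat \<Rightarrow> ('e \<Rightarrow> 'v set) \<Rightarrow> 'v set \<Rightarrow> 'e set \<Rightarrow> ('v \<Rightarrow> 'c set) \<Rightarrow> bool" where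
  "feasible h d V E R \<longleftrightarrow> (\<forall>P. partition_on V P \<longrightarrow> total_need h R P \<le> cut_size d E P)"

lemma need_mono_colours:
  assumes "finite (\<Union>(range R'))" "\<And>v. v \<in> X \<Longrightarrow> R v \<subseteq> R' v"
  shows "need h R' X \<le> need h R X"
  unfolding need_def
  by (rule diff_le_mono2, rule card_mono) (use assms finite_colours in blast)+

lemma need_insert_colour:
  assumes "c \<in> \<Union>(R ` X)"
  shows "need h (R(v := insert c (R v))) X = need h R X"
proof -
  have "\<Union>((R(v := insert c (R v))) ` X) = \<Union>(R ` X)"
    using assms by (auto split: if_splits)
  then show ?thesis by (simp only: need_def)
qed

text \<open>
The edge can carry some colour from \<open>u\<close> to \<open>v\<close>, and \<open>v\<close> still needs colours.
\<close>
definition good_edge ::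
    "nat \<Rightarrow> ('e \<Rightarrow> 'v set) \<Rightarrow> 'e set \<Rightarrow> ('v \<Rightarrow> 'c set) \<Rightarrow> 'e \<Rightarrow> 'v \<Rightarrow> 'v \<Rightarrow> bool" where
  "good_edge h d E R e u v \<longleftrightarrow> e \<in> E \<and> d e = {u, v} \<and> card (R v) < h \<and> \<not> R u \<subseteq> R v"

text \<open>
Otherwise split \<open>Z\<close> into \<open>W\<close>, the vertices all of whose colours occur at \<open>v\<close>, and the rest. An edge
between the two sides would be good, so the refined partition is crossed by no further edges; but
its total need is larger, since \<open>W\<close> alone lacks as many colours as \<open>v\<close>.
\<close>
lemma good_edge_in_tight_part:
  assumes R: "finite (\<Union>(range R))" and V: "finite V" and E: "finite E"
    and ends: "\<And>e. e \<in> E \<Longrightarrow> d e \<subseteq> V \<and> (\<exists>u v. d e = {u, v})"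
    and feas: "feasible h d V E R"
    and P: "partition_on V P" and tight: "total_need h R P = cut_size d E P"
    and Z: "Z \<in> P" and v: "v \<in> Z" and lt: "need h R Z < need h R {v}"
  shows "\<exists>e x y. good_edge h d E R e x y \<and> {x, y} \<subseteq> Z"
proof (rule ccontr)
  assume none: "\<not> ?thesis"
  define W where "W = {w \<in> Z. R w \<subseteq> R v}"
  define P' where "P' = insert W (insert (Z - W) (P - {Z}))"
  have finR: "finite (R w)" for w using finite_subset[OF _ R, of "R w"] by auto
  have finP: "finite P" using P V finite_elements by auto
  have vh: "card (R v) < h" using lt by (simp add: need_def)
  have Wsub: "W \<subseteq> Z" "v \<in> W" using v by (auto simp: W_def)
  have UW: "\<Union>(R ` W) = R v" using v by (auto simp: W_def)
  then have nW: "need h R W = need h R {v}" by (simp add: need_def)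
  have "W \<noteq> Z" using nW lt by auto
  then have ne: "Z - W \<noteq> {}" using Wsub by auto
  have disj: "Y \<inter> Z = {}" if "Y \<in> P - {Z}" for Y
    using that Z in_same_part[OF P, of Y Z] by blast
  have notin: "W \<notin> P - {Z}" "Z - W \<notin> P - {Z}" "W \<noteq> Z - W"
    using disj[of W] disj[of "Z - W"] Wsub ne by auto
  have P': "partition_on V P'"
  proof (rule partition_onI)
    show "\<Union>P' = V" using partition_onD1[OF P] Z Wsub(1) unfolding P'_def by auto
    show "{} \<notin> P'" using partition_onD3[OF P] ne Wsub(2) by (auto simp: P'_def)
    have "disjoint P" using partition_onD2[OF P] .
    then have "disjoint P'"
      using disj Wsub(1) unfolding P'_def disjoint_def by blast
    then show "disjnt p q" if "p \<in> P'" "q \<in> P'" "p \<noteq> q" for p q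
      using that by (auto simp: disjoint_def disjnt_def)
  qed
  have "crossing d P e" if e: "e \<in> E" "crossing d P' e" for e
  proof (rule ccontr)
    assume nc: "\<not> crossing d P e"
    obtain x y where xy: "d e = {x, y}" using ends[OF e(1)] by blast
    obtain A B where AB: "A \<in> P'" "B \<in> P'" "A \<noteq> B" "d e \<inter> A \<noteq> {}" "d e \<inter> B \<noteq> {}"
      using e(2) by (auto simp: crossing_def)
    \<comment> \<open>\<open>up\<close> sends a member of the refined partition to the member of \<open>P\<close> containing it.\<close>
    define up where "up A = (if A \<in> {W, Z - W} then Z else A)" for A
    have up: "up A \<in> P" "A \<subseteq> up A" if "A \<in> P'" for A
      using that Z Wsub(1) by (auto simp: up_def P'_def)
    have "up A = up B" using nc AB up[of A] up[of B] unfolding crossing_def by blast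
    then have "{A, B} = {W, Z - W}"
      using AB(1-3) notin(1,2) by (auto simp: up_def P'_def split: if_splits)
    then obtain a b where ab: "d e = {a, b}" "a \<in> W" "b \<in> Z - W"
      using AB(4,5) xy by (auto simp: doubleton_eq_iff)
    have "R a \<subseteq> R v" "\<not> R b \<subseteq> R v" using ab by (auto simp: W_def)
    then have "good_edge h d E R e b a"
      using e(1) ab(1) vh card_mono[OF finR[of v], of "R a"] by (auto simp: good_edge_def)
    then show False using none ab Wsub(1) by blast
  qed
  then have "cut_size d E P' \<le> cut_size d E P"
    unfolding cut_size_def using E by (intro card_mono) auto
  moreover have "total_need h R P' \<le> cut_size d E P'" using feas P' by (simp add: feasible_def)
  moreover have "total_need h R P' = need h R W + need h R (Z - W) + (\<Sum>X\<in>P-{Z}. need h R X)"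
    unfolding total_need_def P'_def using notin finP by simp
  moreover have "total_need h R P = need h R Z + (\<Sum>X\<in>P-{Z}. need h R X)"
    unfolding total_need_def using finP Z by (simp add: sum.remove)
  ultimately show False using tight nW lt by linarith
qed

text \<open>
Choose a smallest member \<open>X\<close> of a tight partition \<open>P\<close> that contains a good edge \<open>uv\<close>, and a colour \<open>c\<close>
that the edge can carry. If the move violates feasibility at some partition \<open>Q\<close>, then \<open>Q\<close> is tight,
separates \<open>u\<close> from \<open>v\<close>, and its need does not drop. Uncrossing \<open>P\<close> and \<open>Q\<close> with the needs after the
move shows that the member \<open>X \<inter> Y\<close> of the meet does not drop either although \<open>v\<close> does, so it
contains a smaller good edge.
\<close>
lemma extend_along_edge:
  assumes R: "finite (\<Union>(range R))" and V: "finite V" and E: "finite E"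
    and ends: "\<And>e. e \<in> E \<Longrightarrow> d e \<subseteq> V \<and> (\<exists>u v. d e = {u, v})"
    and feas: "feasible h d V E R"
    and w: "w \<in> V" "card (R w) < h"
  shows "\<exists>e u v c. e \<in> E \<and> d e = {u, v} \<and> c \<in> R u \<and> c \<notin> R v \<and> card (R v) < h \<and>
    feasible h d V (E - {e}) (R(v := insert c (R v)))"
proof -
  define tight where "tight P \<longleftrightarrow> partition_on V P \<and> total_need h R P = cut_size d E P" for P
  define cand where "cand X \<longleftrightarrow> (\<exists>P. tight P \<and> X \<in> P) \<and> (\<exists>e x y. good_edge h d E R e x y \<and> {x, y} \<subseteq> X)" for X
  have le: "total_need h R P \<le> cut_size d E P" if "partition_on V P" for P
    using feas that by (simp add: feasible_def)
  have pV: "partition_on V {V}" by (rule partition_on_space) (use w in auto)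
  \<comment> \<open>The trivial partition is tight, which provides a first candidate for \<open>X\<close>.\<close>
  have "cut_size d E {V} = 0" by (simp add: cut_size_def crossing_def)
  then have tV: "tight {V}" using pV le[OF pV] by (simp add: tight_def)
  then have "need h R V = 0" by (simp add: tight_def total_need_def \<open>cut_size d E {V} = 0\<close>)
  moreover have "need h R {w} > 0" using w by (simp add: need_def)
  ultimately have "\<exists>e x y. good_edge h d E R e x y \<and> {x, y} \<subseteq> V"
    using good_edge_in_tight_part[OF R V E ends feas pV, of V w] tV w by (simp add: tight_def)
  then have "cand V" using tV by (auto simp: cand_def)
  then obtain X where X: "cand X" and Xmin: "\<And>Y. cand Y \<Longrightarrow> card X \<le> card Y"
    using ex_has_least_nat[of cand V card] by blast
  obtain P e u v where P: "tight P" "X \<in> P" and e: "good_edge h d E R e u v" "u \<in> X" "v \<in> X"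
    using X unfolding cand_def by blast
  obtain c where c: "c \<in> R u" "c \<notin> R v" using e(1) by (auto simp: good_edge_def)
  have eE: "e \<in> E" "d e = {u, v}" "card (R v) < h" using e(1) by (auto simp: good_edge_def)
  have pP: "partition_on V P" using P by (simp add: tight_def)
  define R' where "R' = R(v := insert c (R v))"
  have "finite (R v)" using finite_subset[OF _ R, of "R v"] by auto
  have "\<Union>(range R') \<subseteq> insert c (\<Union>(range R))" by (auto simp: R'_def split: if_splits)
  then have R': "finite (\<Union>(range R'))"
    using R by (meson finite_insert finite_subset)
  have need': "need h R' Y \<le> need h R Y" for Y
    by (rule need_mono_colours[OF R']) (auto simp: R'_def)
  have tneed': "total_need h R' Q \<le> total_need h R Q" for Q
    unfolding total_need_def by (intro sum_mono need')
  have "feasible h d V (E - {e}) R'"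
    unfolding feasible_def
  proof (rule ccontr)
    assume "\<not> (\<forall>P. partition_on V P \<longrightarrow> total_need h R' P \<le> cut_size d (E - {e}) P)"
    then obtain Q where Q: "partition_on V Q" "cut_size d (E - {e}) Q < total_need h R' Q"
      by (auto simp: not_le)
    have eq: "{f \<in> E - {e}. crossing d Q f} = {f \<in> E. crossing d Q f} - {e}" by auto
    have "cut_size d E Q \<le> Suc (cut_size d (E - {e}) Q)"
      unfolding cut_size_def eq by (simp only: card_Diff_singleton_if split: if_splits) arith
    then have tQ: "total_need h R' Q = cut_size d E Q" "cut_size d (E - {e}) Q \<noteq> cut_size d E Q"
      using Q tneed'[of Q] le[of Q] by linarith+
    have cr: "crossing d Q e"
    proof (rule ccontr)
      assume "\<not> crossing d Q e"
      then have "{f \<in> E - {e}. crossing d Q f} = {f \<in> E. crossing d Q f}" by auto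
      then show False using tQ(2) by (simp add: cut_size_def)
    qed
    then obtain A B where AB: "A \<in> Q" "B \<in> Q" "A \<noteq> B" "{u, v} \<inter> A \<noteq> {}" "{u, v} \<inter> B \<noteq> {}"
      using eE(2) unfolding crossing_def by auto
    then have "u \<notin> A \<or> u \<notin> B" "v \<notin> A \<or> v \<notin> B"
      using in_same_part[OF Q(1) AB(1,2)] by blast+
    with AB obtain Y where Y: "Y \<in> Q" "v \<in> Y" "u \<notin> Y" by auto
    \<comment> \<open>On \<open>P\<close> nothing changes: the member containing \<open>v\<close> also contains \<open>u\<close>, hence the colour \<open>c\<close>.\<close>
    have "need h R' X' = need h R X'" if X': "X' \<in> P" for X'
    proof (cases "X' = X")
      case True
      then show ?thesis unfolding R'_def using c e by (intro need_insert_colour) auto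
    next
      case False
      then have "v \<notin> X'" using in_same_part[OF pP X' P(2)] e by blast
      then have "\<Union>(R' ` X') = \<Union>(R ` X')" by (auto simp: R'_def)
      then show ?thesis by (simp add: need_def)
    qed
    then have tP: "total_need h R' P = cut_size d E P"
      using P(1) by (simp add: tight_def total_need_def)
    obtain J where J: "refines V P J" "refines V Q J"
      "total_need h R' P + total_need h R' Q \<le> total_need h R' (meet P Q) + total_need h R' J"
      using uncross_need[OF R' V pP Q(1)] by blast
    have pJ: "partition_on V J" using J by (simp add: refines_def)
    have pM: "partition_on V (meet P Q)" using partition_on_meet[OF pP Q(1)] .
    have "cut_size d E (meet P Q) + cut_size d E J \<le> cut_size d E P + cut_size d E Q"
      by (rule uncross_cut[OF E _ J(1,2)]) (use ends in auto)
    then have M: "total_need h R' (meet P Q) = total_need h R (meet P Q)"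
      "total_need h R (meet P Q) = cut_size d E (meet P Q)"
      using J(3) tP tQ(1) le[OF pJ] le[OF pM] tneed'[of J] tneed'[of "meet P Q"] by linarith+
    define Z where "Z = X \<inter> Y"
    have Z: "Z \<in> meet P Q" "v \<in> Z" using Y P e by (auto simp: Z_def meet_def)
    have finM: "finite (meet P Q)" using V pM finite_elements by auto
    have "need h R' Z = need h R Z"
      using M(1) finM need' Z(1) unfolding total_need_def
      by (metis (no_types, lifting) sum_mono_inv)
    moreover have "need h R' Z \<le> need h R' {v}"
      by (rule need_antimono[OF R']) (use Z in auto)
    moreover have "need h R' {v} < need h R {v}"
      using eE(3) c(2) \<open>finite (R v)\<close> by (simp add: need_def R'_def)
    ultimately have "need h R Z < need h R {v}" by linarith
    then have "\<exists>e x y. good_edge h d E R e x y \<and> {x, y} \<subseteq> Z"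
      using good_edge_in_tight_part[OF R V E ends feas pM M(2) Z] by simp
    then have "cand Z" using Z(1) pM M(2) by (auto simp: cand_def tight_def)
    then have "card X \<le> card Z" by (rule Xmin)
    moreover have "Z \<subset> X" using e Y by (auto simp: Z_def)
    moreover have "finite X"
      using V pP P(2) by (auto simp: partition_on_def intro: finite_subset)
    ultimately show False using psubset_card_mono[of X Z] by simp
  qed
  then show ?thesis using eE c unfolding R'_def by blast
qed

section \<open>Placing the roots\<close>

text \<open>
Offering more colours everywhere helps a fine partition more than a coarse one: the gain of a member
of \<open>Q\<close> is at most the gain of any member of \<open>M\<close> inside it.
\<close>
lemma uncross_extra_colours:
  assumes R: "finite (\<Union>(range R))" and A: "finite A" "finite B" and V: "finite V"
    and ref: "refines V M Q"
  shows "total_need h (\<lambda>v. R v \<union> A) M + total_need h (\<lambda>v. R v \<union> B) Q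
    \<le> total_need h (\<lambda>v. R v \<union> (A \<inter> B)) M + total_need h (\<lambda>v. R v \<union> (A \<union> B)) Q"
proof -
  let ?n = "\<lambda>L. need h (\<lambda>v. R v \<union> L)"
  have part: "partition_on V M" "partition_on V Q" using ref by (auto simp: refines_def)
  have fin: "finite M" "finite Q" using V part finite_elements by auto
  have "(\<Sum>Y\<in>Q. ?n B Y - ?n (A \<union> B) Y) \<le> (\<Sum>Z\<in>M. ?n (A \<inter> B) Z - ?n A Z)"
  proof (rule sum_le_included[where i = "\<lambda>Z. THE Y. Y \<in> Q \<and> Z \<subseteq> Y"])
    show "\<forall>Y\<in>Q. \<exists>Z\<in>M. (THE Y. Y \<in> Q \<and> Z \<subseteq> Y) = Y \<and>
        ?n B Y - ?n (A \<union> B) Y \<le> ?n (A \<inter> B) Z - ?n A Z"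
    proof
      fix Y assume Y: "Y \<in> Q"
      then have "Y \<noteq> {}" "Y \<subseteq> V" using part(2) by (auto simp: partition_on_def)
      then obtain x where x: "x \<in> Y" "x \<in> V" by auto
      then have "x \<in> \<Union>M" using part(1) by (simp add: partition_on_def)
      then obtain Z where Z: "Z \<in> M" "x \<in> Z" by auto
      then obtain Y' where "Y' \<in> Q" "Z \<subseteq> Y'" using ref unfolding refines_def by meson
      then have ZY: "Z \<subseteq> Y" using in_same_part[OF part(2) _ Y] x Z by blast
      have ne: "X \<noteq> {} \<Longrightarrow> \<Union>((\<lambda>v. R v \<union> L) ` X) = \<Union>(R ` X) \<union> L" for X L by auto
      have "(h - card (\<Union>(R ` Z) \<union> A)) + (h - card (\<Union>(R ` Y) \<union> B))
        \<le> (h - card (\<Union>(R ` Z) \<union> (A \<inter> B))) + (h - card (\<Union>(R ` Y) \<union> (A \<union> B)))"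
        using ZY by (intro truncated_card_supermodular) (use A finite_colours[OF R] in auto)
      moreover have "Z \<noteq> {}" "Y \<noteq> {}" using Z x by auto
      ultimately have "?n A Z + ?n B Y \<le> ?n (A \<inter> B) Z + ?n (A \<union> B) Y"
        by (simp add: need_def ne)
      then have "?n B Y - ?n (A \<union> B) Y \<le> ?n (A \<inter> B) Z - ?n A Z" by arith
      moreover have "(THE Y. Y \<in> Q \<and> Z \<subseteq> Y) = Y"
        by (rule the_equality) (use Z x Y ZY in_same_part[OF part(2)] in blast)+
      ultimately show "\<exists>Z\<in>M. (THE Y. Y \<in> Q \<and> Z \<subseteq> Y) = Y \<and>
        ?n B Y - ?n (A \<union> B) Y \<le> ?n (A \<inter> B) Z - ?n A Z" using Z(1) by blast
    qed
  qed (use fin in auto)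
  moreover have m1: "?n (A \<union> B) Y \<le> ?n B Y" "?n A Y \<le> ?n (A \<inter> B) Y" for Y
    using finite_colours_Un[OF R, of "A \<union> B"] finite_colours_Un[OF R, of A] A
    by (auto intro: need_mono_colours)
  moreover have "(\<Sum>Y\<in>Q. ?n B Y - ?n (A \<union> B) Y) = (\<Sum>Y\<in>Q. ?n B Y) - (\<Sum>Y\<in>Q. ?n (A \<union> B) Y)"
    using m1 by (intro sum_subtractf_nat) auto
  moreover have "(\<Sum>Z\<in>M. ?n (A \<inter> B) Z - ?n A Z) = (\<Sum>Z\<in>M. ?n (A \<inter> B) Z) - (\<Sum>Z\<in>M. ?n A Z)"
    using m1 by (intro sum_subtractf_nat) auto
  moreover have "(\<Sum>Y\<in>Q. ?n (A \<union> B) Y) \<le> (\<Sum>Y\<in>Q. ?n B Y)" "(\<Sum>Z\<in>M. ?n A Z) \<le> (\<Sum>Z\<in>M. ?n (A \<inter> B) Z)"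
    using m1 by (auto intro: sum_mono)
  ultimately show ?thesis unfolding total_need_def by linarith
qed

text \<open>
Supermodularity in the product of the lattice of partitions with the lattice of colour sets. It
follows from supermodularity in the first component and two applications of the previous lemma,
along the chain from the meet through \<open>Q\<close> to \<open>J\<close>.
\<close>
lemma uncross_need_colours:
  assumes R: "finite (\<Union>(range R))" and A: "finite A" "finite B" and V: "finite V"
    and P: "partition_on V P" and Q: "partition_on V Q"
  shows "\<exists>J. refines V P J \<and> refines V Q J \<and>
    total_need h (\<lambda>v. R v \<union> A) P + total_need h (\<lambda>v. R v \<union> B) Q
    \<le> total_need h (\<lambda>v. R v \<union> (A \<inter> B)) (meet P Q) + total_need h (\<lambda>v. R v \<union> (A \<union> B)) J"
proof -
  obtain J where J: "refines V P J" "refines V Q J"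
    "total_need h (\<lambda>v. R v \<union> A) P + total_need h (\<lambda>v. R v \<union> A) Q
      \<le> total_need h (\<lambda>v. R v \<union> A) (meet P Q) + total_need h (\<lambda>v. R v \<union> A) J"
    using uncross_need[OF finite_colours_Un[OF R A(1)] V P Q] by blast
  have eq: "(A \<union> B) \<inter> A = A" "A \<union> B \<union> A = A \<union> B" by auto
  have "total_need h (\<lambda>v. R v \<union> A) (meet P Q) + total_need h (\<lambda>v. R v \<union> B) Q
    \<le> total_need h (\<lambda>v. R v \<union> (A \<inter> B)) (meet P Q) + total_need h (\<lambda>v. R v \<union> (A \<union> B)) Q"
    by (rule uncross_extra_colours[OF R A V refines_meet(2)[OF P Q]])
  moreover have "total_need h (\<lambda>v. R v \<union> (A \<union> B)) Q + total_need h (\<lambda>v. R v \<union> A) J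
    \<le> total_need h (\<lambda>v. R v \<union> A) Q + total_need h (\<lambda>v. R v \<union> (A \<union> B)) J"
    using uncross_extra_colours[OF R _ A(1) V J(2), of "A \<union> B" h] A unfolding eq by simp
  ultimately show ?thesis using J by (intro exI[of _ J]) auto
qed

text \<open>
The colours in \<open>U\<close> are still to be placed, colour \<open>i\<close> at no more than \<open>t i\<close> vertices. Then \<open>t i\<close> is an
upper bound for what colour \<open>i\<close> can contribute to any partition, and so is offering \<open>i\<close> to all
members; the set \<open>L\<close> selects which of the two bounds is used.
\<close>
definition rootable ::
    "nat \<Rightarrow> ('e \<Rightarrow> 'v set) \<Rightarrow> 'v set \<Rightarrow> 'e set \<Rightarrow> ('c \<Rightarrow> nat) \<Rightarrow> ('v \<Rightarrow> 'c set) \<Rightarrow> 'c set \<Rightarrow> bool" where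
  "rootable h d V E t R U \<longleftrightarrow> (\<forall>P L. partition_on V P \<longrightarrow> L \<subseteq> U \<longrightarrow>
     total_need h (\<lambda>v. R v \<union> L) P \<le> cut_size d E P + sum t (U - L))"

definition add_colour :: "'c \<Rightarrow> 'v set \<Rightarrow> ('v \<Rightarrow> 'c set) \<Rightarrow> 'v \<Rightarrow> 'c set" where
  "add_colour c T R v = (if v \<in> T then insert c (R v) else R v)"

lemma finite_add_colour:
  assumes "finite (\<Union>(range R))"
  shows "finite (\<Union>(range (add_colour c T R)))"
  by (rule finite_subset[of _ "insert c (\<Union>(range R))"])
    (use assms in \<open>auto simp: add_colour_def split: if_splits\<close>)

lemma UN_add_colour:
  "\<Union>((\<lambda>v. add_colour c T R v \<union> L) ` X) =
     \<Union>((\<lambda>v. R v \<union> L) ` X) \<union> (if T \<inter> X = {} then {} else {c})"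
  by (auto simp: add_colour_def split: if_splits)

text \<open>
Removing \<open>v\<close> from the root set \<open>T\<close> of colour \<open>c\<close> would increase the need of the member of \<open>P\<close> that
contains \<open>v\<close>, when the colours of \<open>L\<close> are offered everywhere.
\<close>
definition lone :: "nat \<Rightarrow> ('v \<Rightarrow> 'c set) \<Rightarrow> 'c \<Rightarrow> 'v set \<Rightarrow> 'v set set \<Rightarrow> 'c set \<Rightarrow> 'v \<Rightarrow> bool" where
  "lone h R c T P L v \<longleftrightarrow> (\<exists>X\<in>P. v \<in> X \<and> T \<inter> X = {v} \<and> card (\<Union>((\<lambda>v. R v \<union> L) ` X)) < h)"

text \<open>
The property passes to smaller members and smaller colour sets. This is why all essential roots can
be isolated simultaneously by a meet.
\<close>
lemma lone_meet:
  assumes R: "finite (\<Union>(range R))" and fin: "finite L" "finite K"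
    and P: "partition_on V P" and Q: "partition_on V Q" and v: "v \<in> V"
    and lone: "lone h R c T P L v \<or> lone h R c T Q K v"
  shows "lone h R c T (meet P Q) (L \<inter> K) v"
proof -
  have "v \<in> \<Union>P" "v \<in> \<Union>Q" using P Q v by (auto simp: partition_on_def)
  then obtain X Y where XY: "X \<in> P" "v \<in> X" "Y \<in> Q" "v \<in> Y" by auto
  have "T \<inter> X = {v} \<and> card (\<Union>((\<lambda>v. R v \<union> L) ` X)) < h
      \<or> T \<inter> Y = {v} \<and> card (\<Union>((\<lambda>v. R v \<union> K) ` Y)) < h"
    using lone XY in_same_part[OF P] in_same_part[OF Q] unfolding lone_def by metis
  moreover have "card (\<Union>((\<lambda>v. R v \<union> (L \<inter> K)) ` (X \<inter> Y))) \<le> card (\<Union>((\<lambda>v. R v \<union> L) ` X))"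
    by (rule card_mono[OF finite_colours[OF finite_colours_Un[OF R fin(1)]]]) auto
  moreover have "card (\<Union>((\<lambda>v. R v \<union> (L \<inter> K)) ` (X \<inter> Y))) \<le> card (\<Union>((\<lambda>v. R v \<union> K) ` Y))"
    by (rule card_mono[OF finite_colours[OF finite_colours_Un[OF R fin(2)]]]) auto
  ultimately have "T \<inter> (X \<inter> Y) = {v} \<and> card (\<Union>((\<lambda>v. R v \<union> (L \<inter> K)) ` (X \<inter> Y))) < h"
    using XY by (elim disjE conjE) (auto simp: Int_assoc[symmetric])
  moreover have "X \<inter> Y \<in> meet P Q" using XY by (auto simp: meet_def)
  ultimately show ?thesis unfolding lone_def using XY by blast
qed

text \<open>
Placing \<open>c\<close> everywhere is admissible, by the hypothesis for \<open>insert c L\<close>. Take an admissible root set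
\<open>T\<close> of least size. Each root \<open>v\<close> of it is lone in a tight pair, and tight pairs are closed
under meets, so a single tight pair \<open>(P, L)\<close> has all roots lone. There, removing all roots raises the
total need by \<open>card T\<close>, while the hypothesis for \<open>L\<close> itself allows a rise of at most \<open>t c\<close>.
\<close>
lemma place_colour:
  assumes R: "finite (\<Union>(range R))" and V: "finite V" and E: "finite E"
    and ends: "\<forall>e\<in>E. d e \<subseteq> V" and U: "finite U" "c \<in> U" and new: "\<And>v. c \<notin> R v"
    and root: "rootable h d V E t R U"
  shows "\<exists>T\<subseteq>V. card T \<le> t c \<and> rootable h d V E t (add_colour c T R) (U - {c})"
proof -
  let ?U = "U - {c}"
  let ?ok = "\<lambda>T. T \<subseteq> V \<and> rootable h d V E t (add_colour c T R) ?U"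
  let ?n = "\<lambda>T L. total_need h (\<lambda>v. add_colour c T R v \<union> L)"
  have "?ok V"
    unfolding rootable_def
  proof (intro conjI allI impI)
    fix P L assume P: "partition_on V P" and L: "L \<subseteq> ?U"
    have "?n V L P = total_need h (\<lambda>v. R v \<union> insert c L) P"
      unfolding total_need_def
    proof (intro sum.cong refl)
      fix X assume "X \<in> P"
      then have "X \<subseteq> V" "X \<noteq> {}" using P by (auto simp: partition_on_def)
      then have "\<Union>((\<lambda>v. add_colour c V R v \<union> L) ` X) = \<Union>((\<lambda>v. R v \<union> insert c L) ` X)"
        by (auto simp: add_colour_def)
      then show "need h (\<lambda>v. add_colour c V R v \<union> L) X = need h (\<lambda>v. R v \<union> insert c L) X"
        by (simp add: need_def)
    qed
    also have "\<dots> \<le> cut_size d E P + sum t (U - insert c L)"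
      using root P L U(2) unfolding rootable_def by blast
    also have "U - insert c L = ?U - L" by auto
    finally show "?n V L P \<le> cut_size d E P + sum t (?U - L)" .
  qed simp
  then obtain T where T: "?ok T" and Tmin: "\<And>T'. ?ok T' \<Longrightarrow> card T \<le> card T'"
    using ex_has_least_nat[of ?ok V card] by blast
  have finT: "finite T" using T V finite_subset by blast
  have le: "?n T L P \<le> cut_size d E P + sum t (?U - L)" if "partition_on V P" "L \<subseteq> ?U" for P L
    using T that unfolding rootable_def by blast
  define tight where "tight P L \<longleftrightarrow> partition_on V P \<and> L \<subseteq> ?U \<and>
    ?n T L P = cut_size d E P + sum t (?U - L)" for P L
  have single: "\<exists>P L. tight P L \<and> lone h R c T P L v" if v: "v \<in> T" for v
  proof -
    have "\<not> ?ok (T - {v})"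
      using Tmin[of "T - {v}"] v finT by (metis card_Diff1_less not_le)
    then obtain P L where P: "partition_on V P" "L \<subseteq> ?U"
      and gt: "cut_size d E P + sum t (?U - L) < ?n (T - {v}) L P"
      using T unfolding rootable_def by (auto simp: not_le)
    have finP: "finite P" using V P finite_elements by auto
    have finL: "finite L" using P U finite_subset by blast
    let ?m = "\<lambda>T. need h (\<lambda>v. add_colour c T R v \<union> L)"
    let ?C = "\<lambda>X. \<Union>((\<lambda>v. R v \<union> L) ` X)"
    have fr: "finite (?C X)" for X
      by (rule finite_colours[OF finite_colours_Un[OF R finL]])
    \<comment> \<open>A single root changes the total need by at most one, so a violation for \<open>T - {v}\<close> forces
      tightness for \<open>T\<close>.\<close>
    have diff: "?m (T - {v}) X \<le> ?m T X + (if v \<in> X then 1 else 0)" for X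
    proof (cases "v \<in> X")
      case True
      then have ne: "T \<inter> X \<noteq> {}" using v by auto
      have "card (insert c (?C X)) \<le> Suc (card (?C X))" using fr[of X] by (simp add: card_insert_if)
      moreover have "card (?C X) \<le> card (?C X \<union> (if (T - {v}) \<inter> X = {} then {} else {c}))"
        using fr[of X] by (intro card_mono) auto
      ultimately show ?thesis unfolding need_def UN_add_colour using True ne by simp
    next
      case False
      then have "(T - {v}) \<inter> X = T \<inter> X" by auto
      then show ?thesis unfolding need_def UN_add_colour by simp
    qed
    obtain X0 where X0: "X0 \<in> P" "v \<in> X0"
      using P(1) T v unfolding partition_on_def by blast
    have "?n (T - {v}) L P \<le> (\<Sum>X\<in>P. ?m T X + (if v \<in> X then 1 else 0))"
      unfolding total_need_def by (intro sum_mono diff)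
    also have "\<dots> = ?n T L P + (\<Sum>X\<in>P. if v \<in> X then 1 else 0)"
      by (simp add: total_need_def sum.distrib)
    also have "(\<Sum>X\<in>P. if v \<in> X then 1 else 0) = (\<Sum>X\<in>P. if X = X0 then 1 else (0::nat))"
      using X0 in_same_part[OF P(1) _ X0(1)] by (intro sum.cong) auto
    also have "\<dots> = 1" using finP X0 by simp
    finally have t: "tight P L" using gt le[OF P] P by (simp add: tight_def)
    moreover have "\<exists>X\<in>P. ?m T X < ?m (T - {v}) X"
    proof (rule ccontr)
      assume "\<not> ?thesis"
      then have "?n (T - {v}) L P \<le> ?n T L P"
        unfolding total_need_def by (intro sum_mono) (auto simp: not_less)
      then show False using gt le[OF P] by linarith
    qed
    then obtain X where X: "X \<in> P" "?m T X < ?m (T - {v}) X" by blast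
    have ne: "T \<inter> X \<noteq> {} \<and> (T - {v}) \<inter> X = {}"
      using X(2) unfolding need_def UN_add_colour by (auto split: if_splits)
    then have "T \<inter> X = {v}" by auto
    moreover have "card (?C X) < h"
      using X(2) ne unfolding need_def UN_add_colour by auto
    ultimately have "lone h R c T P L v" using X(1) unfolding lone_def by blast
    with t show ?thesis by blast
  qed
  show ?thesis
  proof (cases "T = {}")
    case True
    then show ?thesis using T by (intro exI[of _ T]) auto
  next
    case False
    have "\<exists>P L. tight P L \<and> (\<forall>v\<in>T. lone h R c T P L v)"
    proof -
      have "\<exists>P L. tight P L \<and> (\<forall>v\<in>S. lone h R c T P L v)" if "finite S" "S \<noteq> {}" "S \<subseteq> T" for S
        using that
      proof (induction rule: finite_ne_induct)
        case (singleton v)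
        then show ?case using single by simp
      next
        case (insert v S)
        then obtain P L where P: "tight P L" "\<forall>v\<in>S. lone h R c T P L v" by auto
        obtain Q K where Q: "tight Q K" "lone h R c T Q K v" using insert.prems single[of v] by blast
        have pP: "partition_on V P" "L \<subseteq> ?U" and pQ: "partition_on V Q" "K \<subseteq> ?U"
          using P Q by (auto simp: tight_def)
        have fin: "finite L" "finite K" using U pP(2) pQ(2) finite_subset by blast+
        obtain J where J: "refines V P J" "refines V Q J"
          "?n T L P + ?n T K Q \<le> ?n T (L \<inter> K) (meet P Q) + ?n T (L \<union> K) J"
          using uncross_need_colours[OF finite_add_colour[OF R] fin V pP(1) pQ(1)] by blast
        have pJ: "partition_on V J" using J by (simp add: refines_def)
        have pM: "partition_on V (meet P Q)" using partition_on_meet[OF pP(1) pQ(1)] .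
        have "?U - (L \<inter> K) = (?U - L) \<union> (?U - K)" "?U - (L \<union> K) = (?U - L) \<inter> (?U - K)" by auto
        then have "sum t (?U - (L \<inter> K)) + sum t (?U - (L \<union> K)) = sum t (?U - L) + sum t (?U - K)"
          using U by (simp add: sum.union_inter)
        moreover have "cut_size d E (meet P Q) + cut_size d E J \<le> cut_size d E P + cut_size d E Q"
          by (rule uncross_cut[OF E ends J(1,2)])
        moreover have "L \<inter> K \<subseteq> ?U" "L \<union> K \<subseteq> ?U" using pP pQ by auto
        note le[OF pM this(1)] le[OF pJ this(2)]
        ultimately have "?n T (L \<inter> K) (meet P Q) = cut_size d E (meet P Q) + sum t (?U - (L \<inter> K))"
          using J(3) P(1) Q(1) unfolding tight_def by linarith
        then have "tight (meet P Q) (L \<inter> K)" using pM pP(2) by (auto simp: tight_def)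
        moreover have "lone h R c T (meet P Q) (L \<inter> K) w" if "w \<in> insert v S" for w
          by (rule lone_meet[OF R fin pP(1) pQ(1)]) (use that P Q T insert.prems in auto)
        ultimately show ?case by blast
      qed
      then show ?thesis using finT False by simp
    qed
    then obtain P L where P: "tight P L" "\<And>v. v \<in> T \<Longrightarrow> lone h R c T P L v" by blast
    have pP: "partition_on V P" "L \<subseteq> ?U" using P by (auto simp: tight_def)
    have finP: "finite P" using V pP finite_elements by auto
    have finL: "finite L" using pP U finite_subset by blast
    let ?C = "\<lambda>X. \<Union>((\<lambda>v. R v \<union> L) ` X)"
    have fr: "finite (?C X)" for X
      by (rule finite_colours[OF finite_colours_Un[OF R finL]])
    have "need h (\<lambda>v. add_colour c T R v \<union> L) X + card (T \<inter> X) \<le> need h (\<lambda>v. R v \<union> L) X"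
      if X: "X \<in> P" for X
    proof (cases "T \<inter> X = {}")
      case True
      then show ?thesis unfolding need_def UN_add_colour by simp
    next
      case False
      then obtain v where v: "v \<in> T" "v \<in> X" by auto
      then have *: "T \<inter> X = {v}" "card (?C X) < h"
        using P(2)[OF v(1)] X in_same_part[OF pP(1) X _ v(2)] unfolding lone_def by metis+
      moreover have "c \<notin> ?C X" using new pP(2) by auto
      ultimately show ?thesis unfolding need_def UN_add_colour using fr[of X] by simp
    qed
    then have "?n T L P + (\<Sum>X\<in>P. card (T \<inter> X)) \<le> total_need h (\<lambda>v. R v \<union> L) P"
      unfolding total_need_def sum.distrib[symmetric] by (intro sum_mono)
    moreover have "(\<Sum>X\<in>P. card (T \<inter> X)) = card T"
    proof -
      have "card (\<Union>X\<in>P. T \<inter> X) = (\<Sum>X\<in>P. card (T \<inter> X))"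
        using finP finT in_same_part[OF pP(1)] by (intro card_UN_disjoint) blast+
      moreover have "(\<Union>X\<in>P. T \<inter> X) = T" using T pP(1) by (auto simp: partition_on_def)
      ultimately show ?thesis by simp
    qed
    moreover have "total_need h (\<lambda>v. R v \<union> L) P \<le> cut_size d E P + sum t (U - L)"
      using root pP unfolding rootable_def by blast
    moreover have "U - L = insert c (?U - L)" using U(2) pP(2) by auto
    then have "sum t (U - L) = t c + sum t (?U - L)" using U(1) by simp
    ultimately have "card T \<le> t c" using P(1) unfolding tight_def by linarith
    then show ?thesis using T by blast
  qed
qed

lemma place_all_colours:
  assumes V: "finite V" and E: "finite E" and ends: "\<forall>e\<in>E. d e \<subseteq> V" and U: "finite U"
    and "rootable h d V E t R U" "finite (\<Union>(range R))" "\<And>v. R v \<inter> U = {}"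
  shows "\<exists>R'. (\<forall>v. R v \<subseteq> R' v \<and> R' v \<subseteq> R v \<union> U) \<and>
    (\<forall>c\<in>U. card {v \<in> V. c \<in> R' v} \<le> t c) \<and> feasible h d V E R'"
  using U assms(5-)
proof (induction arbitrary: R rule: finite_induct)
  case empty
  then show ?case by (intro exI[of _ R]) (auto simp: rootable_def feasible_def)
next
  case (insert c U)
  have "c \<notin> R v" for v using insert.prems(3) by auto
  then obtain T where T: "T \<subseteq> V" "card T \<le> t c" "rootable h d V E t (add_colour c T R) (insert c U - {c})"
    using place_colour[OF insert.prems(2) V E ends _ _ _ insert.prems(1), of c] insert.hyps by auto
  have "insert c U - {c} = U" using insert.hyps by auto
  moreover have "finite (\<Union>(range (add_colour c T R)))"
    by (rule finite_add_colour[OF insert.prems(2)])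
  moreover have "add_colour c T R v \<inter> U = {}" for v
    using insert.prems(3)[of v] insert.hyps by (auto simp: add_colour_def)
  ultimately obtain R' where R': "\<forall>v. add_colour c T R v \<subseteq> R' v \<and> R' v \<subseteq> add_colour c T R v \<union> U"
    "\<forall>c\<in>U. card {v \<in> V. c \<in> R' v} \<le> t c" "feasible h d V E R'"
    using insert.IH[of "add_colour c T R"] T(3) by auto
  have "c \<in> R' v \<longleftrightarrow> v \<in> T" for v
    using R'(1) insert.hyps insert.prems(3)[of v] by (auto simp: add_colour_def split: if_splits)
  then have "{v \<in> V. c \<in> R' v} = T" using T(1) by auto
  moreover have "R v \<subseteq> R' v \<and> R' v \<subseteq> R v \<union> insert c U" for v
    using R'(1)[rule_format, of v] by (auto simp: add_colour_def split: if_splits)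
  ultimately show ?case using R'(2,3) T(2) by (intro exI[of _ R']) auto
qed

lemma feasible_mono:
  assumes "feasible h d V E R" "\<And>X. X \<subseteq> V \<Longrightarrow> X \<noteq> {} \<Longrightarrow> need h R' X \<le> need h R X"
  shows "feasible h d V E R'"
  unfolding feasible_def
proof (intro allI impI)
  fix P assume P: "partition_on V P"
  have "total_need h R' P \<le> total_need h R P"
    unfolding total_need_def by (intro sum_mono assms(2)) (use P in \<open>auto simp: partition_on_def\<close>)
  also have "\<dots> \<le> cut_size d E P" using assms(1) P by (simp add: feasible_def)
  finally show "total_need h R' P \<le> cut_size d E P" .
qed

lemma need_zero:
  assumes "finite (\<Union>(range R))" "v \<in> X" "h \<le> card (R v)"
  shows "need h R X = 0"
proof -
  have "card (R v) \<le> card (\<Union>(R ` X))"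
    by (rule card_mono) (use assms finite_colours in auto)
  then show ?thesis using assms(3) by (simp add: need_def)
qed

text \<open>
A vertex with \<open>h\<close> colours makes the need of every set containing it vanish, so surplus colours at it
can be discarded.
\<close>
lemma trim_colours:
  assumes R: "finite (\<Union>(range R))" and feas: "feasible h d V E R"
  shows "\<exists>R'. (\<forall>v. R' v \<subseteq> R v \<and> card (R' v) \<le> h) \<and> feasible h d V E R'"
proof -
  have "\<exists>C. C \<subseteq> R v \<and> card C = min h (card (R v))" for v
    using obtain_subset_with_card_n[of "min h (card (R v))" "R v"] by (metis min.cobounded2)
  then obtain R' where R': "\<And>v. R' v \<subseteq> R v" "\<And>v. card (R' v) = min h (card (R v))"
    by metis
  have fin: "finite (R v)" for v using finite_subset[OF _ R, of "R v"] by auto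
  have finR': "finite (\<Union>(range R'))"
    by (rule finite_subset[OF _ R]) (use R'(1) in blast)
  have "need h R' X \<le> need h R X" for X
  proof (cases "\<exists>v\<in>X. h \<le> card (R v)")
    case True
    then show ?thesis using need_zero[OF finR', of _ X h] R'(2) by (metis min.absorb1 order_refl zero_le)
  next
    case False
    then have "R' v = R v" if "v \<in> X" for v
      using that R' fin by (intro card_subset_eq) (auto simp: not_le)
    then have "\<Union>(R' ` X) = \<Union>(R ` X)" by auto
    then show ?thesis by (simp add: need_def)
  qed
  then have "feasible h d V E R'" by (intro feasible_mono[OF feas])
  then show ?thesis using R' by (intro exI[of _ R']) auto
qed

lemma double_count:
  assumes "finite A" "finite B"
  shows "(\<Sum>a\<in>A. card {b \<in> B. r a b}) = (\<Sum>b\<in>B. card {a \<in> A. r a b})"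
proof -
  have card: "card {b \<in> B. P b} = (\<Sum>b\<in>B. if P b then 1 else 0)" if "finite B" for B :: "'x set" and P
    using that by (simp flip: sum.inter_filter)
  show ?thesis using assms by (simp add: card sum.swap[of _ A B])
qed

text \<open>
If some vertex without colour \<open>i\<close> has room for it, put \<open>i\<close> there. Otherwise take a saturated vertex
\<open>u\<close> without \<open>i\<close> and an unsaturated vertex \<open>w\<close>, which then has \<open>i\<close>. Since \<open>u\<close> has more colours than \<open>w\<close>,
some colour \<open>j\<close> of \<open>u\<close> is missing at \<open>w\<close>; move \<open>j\<close> from \<open>u\<close> to \<open>w\<close> and put \<open>i\<close> in its place. As \<open>u\<close>
remains saturated, no set gets a larger need.
\<close>
lemma raise_colour:
  assumes V: "finite V" and K: "finite K" and R: "\<And>v. R v \<subseteq> K" "\<And>v. v \<in> V \<Longrightarrow> card (R v) \<le> h"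
    and feas: "feasible h d V E R"
    and i: "i \<in> K" "card {v \<in> V. i \<in> R v} < card V" and lt: "(\<Sum>v\<in>V. card (R v)) < h * card V"
  shows "\<exists>R'. (\<forall>v. R' v \<subseteq> K) \<and> (\<forall>v\<in>V. card (R' v) \<le> h) \<and> feasible h d V E R' \<and>
    (\<forall>j. card {v \<in> V. j \<in> R' v} = card {v \<in> V. j \<in> R v} + (if j = i then 1 else 0))"
proof -
  have fin: "finite (\<Union>(range R'))" if "\<And>v. R' v \<subseteq> K" for R'
    by (rule finite_subset[OF _ K]) (use that in blast)
  have finR: "finite (R v)" for v using R(1) K finite_subset by blast
  have insert_count: "card (insert x {v \<in> V. j \<in> R v}) = card {v \<in> V. j \<in> R v} + 1"
    if "j \<notin> R x" for x j using V that by simp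
  show ?thesis
  proof (cases "\<exists>u\<in>V. i \<notin> R u \<and> card (R u) < h")
    case True
    then obtain u where u: "u \<in> V" "i \<notin> R u" "card (R u) < h" by blast
    define R' where "R' = R(u := insert i (R u))"
    have "feasible h d V E R'"
      by (rule feasible_mono[OF feas], rule need_mono_colours, rule fin)
        (use R(1) i in \<open>auto simp: R'_def\<close>)
    moreover have "{v \<in> V. j \<in> R' v} = (if j = i then insert u {v \<in> V. j \<in> R v} else {v \<in> V. j \<in> R v})" for j
      using u by (auto simp: R'_def)
    ultimately show ?thesis using u R i finR insert_count
      by (intro exI[of _ R']) (auto simp: R'_def)
  next
    case False
    have "{v \<in> V. i \<in> R v} \<noteq> V" using i(2) by auto
    then obtain u where u: "u \<in> V" "i \<notin> R u" by auto
    have cu: "card (R u) = h" using u False R(2)[of u] by (auto simp: not_less)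
    obtain w where w: "w \<in> V" "card (R w) < h"
    proof (rule ccontr)
      assume "\<not> thesis"
      then have "\<And>v. v \<in> V \<Longrightarrow> h \<le> card (R v)" using that not_le by blast
      then have "card V * h \<le> (\<Sum>v\<in>V. card (R v))" using sum_bounded_below[of V h "\<lambda>v. card (R v)"] by simp
      then show False using lt by (simp add: mult.commute)
    qed
    have iw: "i \<in> R w" using w False by auto
    have "\<not> R u \<subseteq> R w" using cu w(2) card_mono[OF finR[of w], of "R u"] by auto
    then obtain j where j: "j \<in> R u" "j \<notin> R w" by auto
    have ne: "u \<noteq> w" "i \<noteq> j" using iw u j by auto
    define R' where "R' = R(u := insert i (R u - {j}), w := insert j (R w))"
    have cu': "card (R' u) = h" using cu u j finR[of u] ne by (simp add: R'_def card_Diff_singleton)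
       (metis Suc_pred card_gt_0_iff empty_iff)
    have sub: "R' v \<subseteq> K" for v using R(1)[of u] R(1)[of v] R(1)[of w] i(1) j by (auto simp: R'_def)
    have "need h R' X \<le> need h R X" for X
    proof (cases "u \<in> X")
      case True
      then show ?thesis using need_zero[OF fin[of R'] True] sub cu' by simp
    next
      case False
      then show ?thesis by (intro need_mono_colours[OF fin[of R']] sub) (auto simp: R'_def)
    qed
    then have "feasible h d V E R'" by (intro feasible_mono[OF feas])
    moreover have "card {v \<in> V. m \<in> R' v} = card {v \<in> V. m \<in> R v} + (if m = i then 1 else 0)" for m
    proof -
      consider "m = i" | "m = j" | "m \<noteq> i" "m \<noteq> j" by blast
      then show ?thesis
      proof cases
        case 1
        then have "{v \<in> V. m \<in> R' v} = insert u {v \<in> V. m \<in> R v}" using u ne iw by (auto simp: R'_def)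
        then show ?thesis using insert_count[of m u] 1 u by simp
      next
        case 2
        then have "{v \<in> V. m \<in> R' v} = insert w ({v \<in> V. m \<in> R v} - {u})" using w ne by (auto simp: R'_def)
        moreover have "u \<in> {v \<in> V. m \<in> R v}" using 2 u j by simp
        ultimately show ?thesis using V 2 ne j(2) by (simp add: card_Suc_Diff1 del: card_Diff_insert)
      next
        case 3
        then have "{v \<in> V. m \<in> R' v} = {v \<in> V. m \<in> R v}" by (auto simp: R'_def)
        then show ?thesis using 3 by simp
      qed
    qed
    moreover have "card (R' v) \<le> h" if "v \<in> V" for v
      using R(2)[OF that] cu' w(2) finR[of w] ne j by (cases "v = u"; cases "v = w") (auto simp: R'_def)
    ultimately show ?thesis using sub by (intro exI[of _ R']) auto
  qed
qed

lemma raise_all_colours: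
  assumes V: "finite V" and K: "finite K"
    and t: "\<And>i. i \<in> K \<Longrightarrow> t i \<le> card V" "sum t K \<le> h * card V"
  shows "(\<And>v. R v \<subseteq> K) \<Longrightarrow> (\<And>v. v \<in> V \<Longrightarrow> card (R v) \<le> h) \<Longrightarrow> feasible h d V E R \<Longrightarrow>
      (\<And>i. i \<in> K \<Longrightarrow> card {v \<in> V. i \<in> R v} \<le> t i) \<Longrightarrow>
    \<exists>R'. (\<forall>v. R' v \<subseteq> K) \<and> (\<forall>v\<in>V. card (R' v) \<le> h) \<and> feasible h d V E R' \<and>
      (\<forall>i\<in>K. card {v \<in> V. i \<in> R' v} = t i)"
proof (induction "\<Sum>i\<in>K. t i - card {v \<in> V. i \<in> R v}" arbitrary: R rule: less_induct)
  case less
  show ?case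
  proof (cases "\<forall>i\<in>K. card {v \<in> V. i \<in> R v} = t i")
    case True
    then show ?thesis using less.prems by blast
  next
    case False
    then obtain i where i: "i \<in> K" "card {v \<in> V. i \<in> R v} < t i"
      using less.prems(4) by (meson le_neq_implies_less)
    have "{j \<in> K. j \<in> R v} = R v" for v using less.prems(1) by auto
    then have "(\<Sum>v\<in>V. card (R v)) = (\<Sum>j\<in>K. card {v \<in> V. j \<in> R v})"
      using double_count[OF V K, of "\<lambda>v j. j \<in> R v"] by simp
    also have "\<dots> < sum t K" using i less.prems(4) K by (intro sum_strict_mono_ex1) auto
    finally have lt: "(\<Sum>v\<in>V. card (R v)) < h * card V" using t(2) by simp
    have "card {v \<in> V. i \<in> R v} < card V" using i t(1)[OF i(1)] by simp
    then obtain R' where R': "\<forall>v. R' v \<subseteq> K" "\<forall>v\<in>V. card (R' v) \<le> h" "feasible h d V E R'"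
      "\<forall>j. card {v \<in> V. j \<in> R' v} = card {v \<in> V. j \<in> R v} + (if j = i then 1 else 0)"
      using raise_colour[OF V K less.prems(1-3) i(1) _ lt] by blast
    show ?thesis
    proof (rule less.hyps[of R'])
      show "(\<Sum>j\<in>K. t j - card {v \<in> V. j \<in> R' v}) < (\<Sum>j\<in>K. t j - card {v \<in> V. j \<in> R v})"
        using i K R'(4) by (intro sum_strict_mono_ex1) auto
      show "card {v \<in> V. j \<in> R' v} \<le> t j" if "j \<in> K" for j
        using R'(4)[rule_format, of j] less.prems(4)[OF that] i by (auto split: if_splits)
    qed (use R' in auto)
  qed
qed

text \<open>
Before any root is placed, all members of a partition lack the same number of colours, and for each
colour \<open>min (t i) (card P)\<close> is at most \<open>t i\<close> and at most \<open>card P\<close>; using the first bound outside \<open>L\<close>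
and the second inside \<open>L\<close> turns the hypothesis into \<open>rootable\<close>.
\<close>
lemma ex_roots:
  assumes V: "finite V" and E: "finite E" and ends: "\<forall>e\<in>E. d e \<subseteq> V" and K: "finite K"
    and t: "\<And>i. i \<in> K \<Longrightarrow> t i \<le> card V" "sum t K \<le> h * card V"
    and cond: "\<And>P. partition_on V P \<Longrightarrow> h * card P \<le> (\<Sum>i\<in>K. min (t i) (card P)) + cut_size d E P"
  shows "\<exists>R. (\<forall>v. R v \<subseteq> K) \<and> (\<forall>v\<in>V. card (R v) \<le> h) \<and> feasible h d V E R \<and>
      (\<forall>i\<in>K. card {v \<in> V. i \<in> R v} = t i)"
proof -
  have "rootable h d V E t (\<lambda>v. {}) K"
    unfolding rootable_def
  proof (intro allI impI)
    fix P L assume P: "partition_on V P" and L: "L \<subseteq> K"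
    have finL: "finite L" using L K finite_subset by blast
    have "total_need h (\<lambda>v. {} \<union> L) P = (\<Sum>X\<in>P. h - card L)"
      unfolding total_need_def need_def
      by (intro sum.cong refl) (use partition_onD3[OF P] in auto)
    also have "\<dots> = h * card P - card L * card P" by (simp add: diff_mult_distrib2 mult.commute)
    finally have n: "total_need h (\<lambda>v. {} \<union> L) P = h * card P - card L * card P" .
    have "(\<Sum>i\<in>K. min (t i) (card P)) = (\<Sum>i\<in>L. min (t i) (card P)) + (\<Sum>i\<in>K-L. min (t i) (card P))"
      using K L by (metis add.commute sum.subset_diff)
    also have "\<dots> \<le> (\<Sum>i\<in>L. card P) + sum t (K - L)"
      by (intro add_mono sum_mono) auto
    finally show "total_need h (\<lambda>v. {} \<union> L) P \<le> cut_size d E P + sum t (K - L)"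
      using cond[OF P] n by simp
  qed
  then obtain R where R: "\<forall>v. R v \<subseteq> K" "\<forall>c\<in>K. card {v \<in> V. c \<in> R v} \<le> t c" "feasible h d V E R"
    using place_all_colours[OF V E ends K] by force
  have "finite (\<Union>(range R))" by (rule finite_subset[OF _ K]) (use R in auto)
  then obtain R' where R': "\<forall>v. R' v \<subseteq> R v \<and> card (R' v) \<le> h" "feasible h d V E R'"
    using trim_colours R(3) by blast
  show ?thesis
  proof (rule raise_all_colours[OF V K t, of R'])
    show "R' v \<subseteq> K" for v using R R' by blast
    show "card {v \<in> V. i \<in> R' v} \<le> t i" if "i \<in> K" for i
    proof -
      have "card {v \<in> V. i \<in> R' v} \<le> card {v \<in> V. i \<in> R v}"
        using R' V by (intro card_mono) auto
      then show ?thesis using R(2) that by (meson order_trans)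
    qed
  qed (use R' in auto)
qed

section \<open>Choosing the numbers of components\<close>

text \<open>
Start from \<open>l\<close> and repeatedly increase a smallest value that is still below its upper bound.
\<close>
lemma ex_balanced:
  fixes l u :: "'a \<Rightarrow> nat"
  assumes K: "finite K" and lu: "\<And>i. i \<in> K \<Longrightarrow> l i \<le> u i" and B: "sum l K \<le> B" "B \<le> sum u K"
  shows "\<exists>c. (\<forall>i\<in>K. l i \<le> c i \<and> c i \<le> u i) \<and> sum c K = B \<and>
    (\<forall>i\<in>K. \<forall>j\<in>K. c j < u j \<longrightarrow> l i < c i \<longrightarrow> c i \<le> Suc (c j))"
  using B
proof (induction B rule: dec_induct)
  case base
  then show ?case using lu by (intro exI[of _ l]) auto
next
  case (step B)
  then obtain c where c: "\<forall>i\<in>K. l i \<le> c i \<and> c i \<le> u i" "sum c K = B"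
    "\<And>i j. i \<in> K \<Longrightarrow> j \<in> K \<Longrightarrow> c j < u j \<Longrightarrow> l i < c i \<Longrightarrow> c i \<le> Suc (c j)" by auto
  have "\<exists>j\<in>K. c j < u j"
  proof (rule ccontr)
    assume "\<not> ?thesis"
    then have "sum u K \<le> sum c K" by (intro sum_mono) (auto simp: not_less)
    then show False using c(2) step.prems by simp
  qed
  then obtain j where j: "j \<in> K" "c j < u j" and jmin: "\<And>m. m \<in> K \<Longrightarrow> c m < u m \<Longrightarrow> c j \<le> c m"
    using ex_has_least_nat[of "\<lambda>j. j \<in> K \<and> c j < u j" _ c] by blast
  define c' where "c' = c(j := Suc (c j))"
  have "sum c' K = Suc (c j) + sum c (K - {j})"
    using K j by (simp add: c'_def sum.remove)
  also have "\<dots> = Suc B" using K j c(2) by (simp add: sum.remove)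
  finally have "sum c' K = Suc B" .
  moreover have "c' i \<le> Suc (c' m)" if "i \<in> K" "m \<in> K" "c' m < u m" "l i < c' i" for i m
  proof (cases "i = j")
    case True
    then show ?thesis using that jmin[of m] by (auto simp: c'_def split: if_splits)
  next
    case False
    then have "c i \<le> Suc (c m)" using that by (intro c(3)) (auto simp: c'_def split: if_splits)
    then show ?thesis using False by (auto simp: c'_def)
  qed
  moreover have "\<forall>i\<in>K. l i \<le> c' i \<and> c' i \<le> u i" using c(1) j by (auto simp: c'_def)
  ultimately show ?case by blast
qed

text \<open>
Unless every \<open>min (c j) p\<close> is as large as \<open>u j\<close> allows, some \<open>c j < p\<close> could be increased. Balance then
forces every \<open>c i\<close> above its lower bound to be at most \<open>p\<close>, so that truncation at \<open>p\<close> removes from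
\<open>c i\<close> no more than from \<open>l i\<close>.
\<close>
lemma balanced_min_sum:
  fixes l u c :: "'a \<Rightarrow> nat"
  assumes c: "\<forall>i\<in>K. l i \<le> c i \<and> c i \<le> u i"
    "\<forall>i\<in>K. \<forall>j\<in>K. c j < u j \<longrightarrow> l i < c i \<longrightarrow> c i \<le> Suc (c j)"
  shows "(\<Sum>i\<in>K. min (u i) p) \<le> (\<Sum>i\<in>K. min (c i) p) \<or>
    sum c K + (\<Sum>i\<in>K. min (l i) p) \<le> sum l K + (\<Sum>i\<in>K. min (c i) p)"
proof (cases "\<forall>j\<in>K. c j < u j \<longrightarrow> p \<le> c j")
  case True
  have "(\<Sum>i\<in>K. min (u i) p) \<le> (\<Sum>i\<in>K. min (c i) p)"
  proof (rule sum_mono)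
    fix i assume "i \<in> K"
    then show "min (u i) p \<le> min (c i) p" using True c(1) by (cases "c i < u i") auto
  qed
  then show ?thesis by blast
next
  case False
  then obtain j where j: "j \<in> K" "c j < u j" "c j < p" by auto
  have "sum c K + (\<Sum>i\<in>K. min (l i) p) \<le> sum l K + (\<Sum>i\<in>K. min (c i) p)"
    unfolding sum.distrib[symmetric]
  proof (rule sum_mono)
    fix i assume i: "i \<in> K"
    then show "c i + min (l i) p \<le> l i + min (c i) p"
      using c(1) c(2)[rule_format, OF i j(1) j(2)] j(3) by (cases "l i < c i") force+
  qed
  then show ?thesis by blast
qed

section \<open>Growing the forests\<close>

lemma sym_adj: "sym (adj G)"
  by (auto simp: adj_def sym_def insert_commute)

text \<open>
The map \<open>\<rho>\<close> sends each vertex to the root of its component. In this form it is immediate that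
attaching a leaf changes neither the roots nor their number.
\<close>
definition rooted :: "('v, 'e) ugraph \<Rightarrow> 'v set \<Rightarrow> bool" where
  "rooted F T \<longleftrightarrow> T \<subseteq> verts F \<and> (\<exists>\<rho>. (\<forall>v\<in>verts F. \<rho> v \<in> T \<and> (v, \<rho> v) \<in> (adj F)\<^sup>*) \<and>
     (\<forall>t\<in>T. \<rho> t = t) \<and> (\<forall>(x, y)\<in>adj F. \<rho> x = \<rho> y))"

lemma num_components_rooted:
  assumes "rooted F T"
  shows "num_components F = card T"
proof -
  obtain \<rho> where \<rho>: "\<And>v. v \<in> verts F \<Longrightarrow> \<rho> v \<in> T \<and> (v, \<rho> v) \<in> (adj F)\<^sup>*"
    "\<And>t. t \<in> T \<Longrightarrow> \<rho> t = t" "\<And>x y. (x, y) \<in> adj F \<Longrightarrow> \<rho> x = \<rho> y"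
    and T: "T \<subseteq> verts F"
    using assms unfolding rooted_def by blast
  let ?r = "(adj F)\<^sup>*"
  have sym: "sym ?r" by (rule sym_rtrancl[OF sym_adj])
  have const: "\<rho> x = \<rho> y" if "(x, y) \<in> ?r" for x y
    using that by induction (auto dest: \<rho>(3))
  have same_class: "?r `` {x} = ?r `` {y}" if "(x, y) \<in> ?r" for x y
    using that symD[OF sym that] by (auto intro: rtrancl_trans)
  have "components F = (\<lambda>t. ?r `` {t}) ` T"
    unfolding components_def quotient_def
  proof (intro equalityI subsetI)
    fix C assume "C \<in> (\<Union>x\<in>verts F. {?r `` {x}})"
    then obtain x where "x \<in> verts F" "C = ?r `` {x}" by auto
    then show "C \<in> (\<lambda>t. ?r `` {t}) ` T" using \<rho>(1)[of x] same_class[of x "\<rho> x"] by auto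
  qed (use T in auto)
  moreover have "inj_on (\<lambda>t. ?r `` {t}) T"
  proof (rule inj_onI)
    fix s t assume st: "s \<in> T" "t \<in> T" "?r `` {s} = ?r `` {t}"
    then have "(s, t) \<in> ?r" by auto
    then show "s = t" using const[of s t] \<rho>(2) st by simp
  qed
  ultimately show ?thesis unfolding num_components_def by (simp add: card_image)
qed

text \<open>
A cycle through the new vertex would use two different edges at it, or a loop.
\<close>
lemma forest_add_leaf:
  assumes F: "forest F" and uv: "u \<in> verts F" "v \<notin> verts F" and e: "ends F e = {u, v}"
  shows "forest (F\<lparr>verts := insert v (verts F), edges := insert e (edges F)\<rparr>)" (is "forest ?F'")
proof -
  have gF: "graph F" using F by (simp add: forest_def)
  have ne: "u \<noteq> v" using uv by auto
  have "graph ?F'" using gF uv e ne by (auto simp: graph_def)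
  moreover have False if cyc: "is_cycle ?F' vs es" for vs es
  proof -
    let ?n = "length vs"
    have c: "vs \<noteq> []" "length es = ?n" "distinct vs" "distinct es" "set vs \<subseteq> insert v (verts F)"
      "set es \<subseteq> insert e (edges F)"
      "\<And>i. i < ?n \<Longrightarrow> ends F (es ! i) = {vs ! i, vs ! (Suc i mod ?n)}"
      using cyc by (auto simp: is_cycle_def)
    have inF: "ends F (es ! i) \<subseteq> verts F" if "i < ?n" "es ! i \<noteq> e" for i
    proof -
      have "es ! i \<in> set es" using that c(2) by simp
      then have "es ! i \<in> edges F" using that(2) c(6) by auto
      then show ?thesis using gF by (simp add: graph_def)
    qed
    show False
    proof (cases "v \<in> set vs")
      case True
      then obtain j where j: "j < ?n" "vs ! j = v" by (auto simp: in_set_conv_nth)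
      \<comment> \<open>The edges of the cycle with indices \<open>p\<close> and \<open>j\<close> are the two edges at its \<open>j\<close>-th vertex.\<close>
      define p where "p = (if j = 0 then ?n - 1 else j - 1)"
      have p: "p < ?n" "Suc p mod ?n = j" using j by (auto simp: p_def)
      have "es ! j = e" using inF[of j] c(7)[of j] j uv by auto
      moreover have "es ! p = e" using inF[of p] c(7)[of p] p j uv by auto
      ultimately have "j = p" using c(2,4) j p by (metis nth_eq_iff_index_eq)
      then have "?n \<le> 1" using j by (auto simp: p_def split: if_splits)
      then have "?n = 1" using j by simp
      then have "ends F e = {v}" using c(7)[of 0] j \<open>es ! j = e\<close> by simp
      then show False using e ne by auto
    next
      case False
      have "es ! i \<noteq> e" if "i < ?n" for i
      proof
        assume "es ! i = e"
        then have "v \<in> {vs ! i, vs ! (Suc i mod ?n)}" using c(7)[OF that] e by blast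
        moreover have "Suc i mod ?n < ?n" using that by (intro mod_less_divisor) linarith
        ultimately show False using False that nth_mem by auto
      qed
      then have "e \<notin> set es" using c(2) by (auto simp: in_set_conv_nth)
      then have "is_cycle F vs es" using c False by (auto simp: is_cycle_def)
      then show False using F by (auto simp: forest_def)
    qed
  qed
  ultimately show ?thesis by (auto simp: forest_def)
qed

lemma rooted_add_leaf:
  assumes F: "graph F" "rooted F T" and uv: "u \<in> verts F" "v \<notin> verts F" and e: "ends F e = {u, v}"
  shows "rooted (F\<lparr>verts := insert v (verts F), edges := insert e (edges F)\<rparr>) T" (is "rooted ?F' T")
proof -
  obtain \<rho> where \<rho>: "\<And>v. v \<in> verts F \<Longrightarrow> \<rho> v \<in> T \<and> (v, \<rho> v) \<in> (adj F)\<^sup>*"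
    "\<And>t. t \<in> T \<Longrightarrow> \<rho> t = t" "\<And>x y. (x, y) \<in> adj F \<Longrightarrow> \<rho> x = \<rho> y"
    and T: "T \<subseteq> verts F"
    using F(2) unfolding rooted_def by blast
  have adj': "adj ?F' = adj F \<union> {(u, v), (v, u)}"
    using e by (auto simp: adj_def doubleton_eq_iff)
  have sub: "(adj F)\<^sup>* \<subseteq> (adj ?F')\<^sup>*" unfolding adj' by (rule rtrancl_mono) auto
  have V: "x \<in> verts F \<and> y \<in> verts F" if "(x, y) \<in> adj F" for x y
    using that F(1) by (auto simp: adj_def graph_def)
  define \<rho>' where "\<rho>' = \<rho>(v := \<rho> u)"
  have "(v, \<rho> u) \<in> (adj ?F')\<^sup>*"
    using \<rho>(1)[OF uv(1)] sub by (intro converse_rtrancl_into_rtrancl[of v u]) (auto simp: adj')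
  then have "\<forall>w\<in>verts ?F'. \<rho>' w \<in> T \<and> (w, \<rho>' w) \<in> (adj ?F')\<^sup>*"
    using \<rho>(1) uv sub by (auto simp: \<rho>'_def)
  moreover have "\<forall>t\<in>T. \<rho>' t = t" using \<rho>(2) T uv(2) by (auto simp: \<rho>'_def)
  moreover have "\<forall>(x, y)\<in>adj ?F'. \<rho>' x = \<rho>' y"
    using \<rho>(3) V uv by (auto simp: adj' \<rho>'_def)
  ultimately show ?thesis using T unfolding rooted_def by auto
qed

definition piece :: "('v, 'e) ugraph \<Rightarrow> ('v \<Rightarrow> 'c set) \<Rightarrow> ('c \<Rightarrow> 'e set) \<Rightarrow> 'c \<Rightarrow> ('v, 'e) ugraph" where
  "piece G R A i = \<lparr>verts = {v \<in> verts G. i \<in> R v}, edges = A i, ends = ends G\<rparr>"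

text \<open>
Induction on the number of unused edges. The step given by \<open>extend_along_edge\<close> attaches \<open>v\<close> as a leaf
at \<open>u\<close> to the forest of colour \<open>c\<close> and leaves all other forests alone.
\<close>
lemma grow_forests:
  assumes G: "graph G" and K: "finite K"
  shows "(\<And>v. R v \<subseteq> K) \<Longrightarrow> (\<And>v. v \<in> verts G \<Longrightarrow> card (R v) \<le> h) \<Longrightarrow>
      feasible h (ends G) (verts G) E R \<Longrightarrow> E \<subseteq> edges G \<Longrightarrow>
      (\<And>i. i \<in> K \<Longrightarrow> A i \<subseteq> edges G - E) \<Longrightarrow> disjoint_family_on A K \<Longrightarrow>
      (\<And>i. i \<in> K \<Longrightarrow> forest (piece G R A i) \<and> rooted (piece G R A i) (T i)) \<Longrightarrow>
    \<exists>R A. (\<forall>v. R v \<subseteq> K) \<and> (\<forall>v\<in>verts G. card (R v) = h) \<and> (\<forall>i\<in>K. A i \<subseteq> edges G) \<and>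
      disjoint_family_on A K \<and> (\<forall>i\<in>K. forest (piece G R A i) \<and> rooted (piece G R A i) (T i))"
proof (induction "card E" arbitrary: E R A rule: less_induct)
  case less
  show ?case
  proof (cases "\<forall>v\<in>verts G. card (R v) = h")
    case True
    then show ?thesis using less.prems by (intro exI[of _ R] exI[of _ A]) blast
  next
    case False
    then obtain w where w: "w \<in> verts G" "card (R w) < h"
      using less.prems(2) by (meson le_neq_implies_less)
    have V: "finite (verts G)" and finE: "finite E"
      using G less.prems(4) finite_subset by (auto simp: graph_def)
    have ends: "ends G e \<subseteq> verts G \<and> (\<exists>u v. ends G e = {u, v})" if "e \<in> E" for e
    proof -
      have "ends G e \<subseteq> verts G" "card (ends G e) \<in> {1, 2}"
        using that less.prems(4) G by (auto simp: graph_def)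
      then show ?thesis by (auto simp: card_1_singleton_iff card_2_iff)
    qed
    have "finite (\<Union>(range R))" by (rule finite_subset[OF _ K]) (use less.prems(1) in auto)
    then obtain e u v c where e: "e \<in> E" "ends G e = {u, v}" and c: "c \<in> R u" "c \<notin> R v" "card (R v) < h"
      and feas: "feasible h (ends G) (verts G) (E - {e}) (R(v := insert c (R v)))"
      using extend_along_edge[OF _ V finE ends less.prems(3) w] by blast
    have cK: "c \<in> K" using c less.prems(1) by auto
    have uv: "u \<in> verts G" "v \<in> verts G" using ends[OF e(1)] e(2) by auto
    define R' where "R' = R(v := insert c (R v))"
    define A' where "A' = A(c := insert e (A c))"
    have same: "piece G R' A' i = piece G R A i" if "i \<noteq> c" for i
      using that by (auto simp: piece_def R'_def A'_def)
    have leaf: "piece G R' A' c = (piece G R A c)\<lparr>verts := insert v (verts (piece G R A c)),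
        edges := insert e (edges (piece G R A c))\<rparr>"
      using uv by (auto simp: piece_def R'_def A'_def)
    have old: "forest (piece G R A c)" "rooted (piece G R A c) (T c)" "graph (piece G R A c)"
      using less.prems(7)[OF cK] by (auto simp: forest_def)
    have mem: "u \<in> verts (piece G R A c)" "v \<notin> verts (piece G R A c)" "ends (piece G R A c) e = {u, v}"
      using c uv e by (auto simp: piece_def)
    have new: "forest (piece G R' A' i) \<and> rooted (piece G R' A' i) (T i)" if "i \<in> K" for i
    proof (cases "i = c")
      case True
      then show ?thesis
        using forest_add_leaf[OF old(1) mem] rooted_add_leaf[OF old(3,2) mem] leaf by simp
    next
      case False
      then show ?thesis using same less.prems(7)[OF that] by simp
    qed
    have notA: "e \<notin> A i" if "i \<in> K" for i using less.prems(5)[OF that] e(1) by auto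
    show ?thesis
    proof (rule less.hyps[of "E - {e}" R' A'])
      show "card (E - {e}) < card E" using e(1) finE by (meson card_Diff1_less)
      show "R' x \<subseteq> K" for x using less.prems(1) cK by (auto simp: R'_def)
      show "card (R' x) \<le> h" if "x \<in> verts G" for x
        using less.prems(2)[OF that] c finite_subset[OF less.prems(1) K, of v] by (auto simp: R'_def)
      show "A' i \<subseteq> edges G - (E - {e})" if "i \<in> K" for i
        using less.prems(4) less.prems(5)[OF that] e(1) by (auto simp: A'_def)
      show "disjoint_family_on A' K"
        using less.prems(6) notA by (auto simp: disjoint_family_on_def A'_def)
    qed (use feas less.prems(4) new in \<open>auto simp: R'_def\<close>)
  qed
qed

section \<open>Components and crossing edges\<close>

text \<open>
Apart from the class of \<open>y\<close>, different classes stay different when \<open>x\<close> and \<open>y\<close> are joined.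
\<close>
lemma card_quotient_join:
  fixes r :: "'v rel"
  assumes V: "finite V" and r: "sym r"
  shows "card (V // r\<^sup>*) \<le> Suc (card (V // (insert (x, y) (insert (y, x) r))\<^sup>*))"
proof -
  let ?r' = "insert (x, y) (insert (y, x) r)"
  let ?Q = "V // r\<^sup>* - {r\<^sup>* `` {y}}"
  have sub: "r\<^sup>* \<subseteq> ?r'\<^sup>*" by (rule rtrancl_mono) auto
  have sym: "sym (r\<^sup>*)" by (rule sym_rtrancl[OF r])
  have same_class: "r\<^sup>* `` {a} = r\<^sup>* `` {b}" if "(a, b) \<in> r\<^sup>*" for a b
    using that symD[OF sym that] by (auto intro: rtrancl_trans)
  have im: "?r'\<^sup>* `` (r\<^sup>* `` {a}) = ?r'\<^sup>* `` {a}" for a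
    using sub by (auto intro: rtrancl_trans)
  have fin: "finite (V // s)" for s using V by (simp add: quotient_def)
  have "inj_on (\<lambda>C. ?r'\<^sup>* `` C) ?Q"
  proof (rule inj_onI)
    fix C D assume CD: "C \<in> ?Q" "D \<in> ?Q" "?r'\<^sup>* `` C = ?r'\<^sup>* `` D"
    obtain a b where ab: "C = r\<^sup>* `` {a}" "D = r\<^sup>* `` {b}"
      using CD(1,2) by (auto elim!: quotientE)
    have "?r'\<^sup>* `` {a} = ?r'\<^sup>* `` {b}" using CD(3) by (simp add: ab im)
    then have "(a, b) \<in> ?r'\<^sup>*" by auto
    moreover have "(a, y) \<notin> r\<^sup>*" "(b, y) \<notin> r\<^sup>*" "(y, b) \<notin> r\<^sup>*"
      using CD(1,2) same_class symD[OF sym] by (auto simp: ab)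
    ultimately have "(a, b) \<in> r\<^sup>*"
      unfolding rtrancl_insert by (auto intro: rtrancl_trans)
    then show "C = D" using same_class ab by simp
  qed
  moreover have "(\<lambda>C. ?r'\<^sup>* `` C) ` ?Q \<subseteq> V // ?r'\<^sup>*"
    by (auto simp: im elim!: quotientE intro: quotientI)
  ultimately have "card ?Q \<le> card (V // ?r'\<^sup>*)" using fin by (metis card_inj_on_le)
  moreover have "card (V // r\<^sup>*) \<le> Suc (card ?Q)"
    using fin[of "r\<^sup>*"] by (simp add: card_Diff_singleton_if) arith
  ultimately show ?thesis by linarith
qed

lemma num_components_delete:
  assumes F: "graph F" and D: "finite D" "D \<subseteq> edges F"
  shows "num_components (F\<lparr>edges := edges F - D\<rparr>) \<le> num_components F + card D"
  using D
proof (induction D rule: finite_induct)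
  case (insert e D)
  let ?F = "\<lambda>D. F\<lparr>edges := edges F - D\<rparr>"
  have "card (ends F e) \<in> {1, 2}" using insert.prems F by (auto simp: graph_def)
  then obtain x y where xy: "ends F e = {x, y}" by (auto simp: card_1_singleton_iff card_2_iff)
  have "edges F - D = insert e (edges F - insert e D)" using insert.hyps insert.prems by auto
  then have "adj (?F D) = insert (x, y) (insert (y, x) (adj (?F (insert e D))))"
    using xy by (auto simp: adj_def doubleton_eq_iff)
  then have "num_components (?F (insert e D)) \<le> Suc (num_components (?F D))"
    using card_quotient_join[of "verts F" "adj (?F (insert e D))" x y] F sym_adj[of "?F (insert e D)"]
    by (simp add: num_components_def components_def graph_def)
  then show ?case using insert by simp
qed simp

text \<open>
After deletion of the crossing edges, no component meets two members of \<open>P\<close>.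
\<close>
lemma parts_met_le:
  assumes F: "graph F" and P: "partition_on V P" and V: "verts F \<subseteq> V"
  shows "card {X \<in> P. X \<inter> verts F \<noteq> {}} \<le> num_components F + cut_size (ends F) (edges F) P"
proof -
  define D where "D = {e \<in> edges F. crossing (ends F) P e}"
  let ?F = "F\<lparr>edges := edges F - D\<rparr>"
  let ?r = "(adj ?F)\<^sup>*"
  have stay: "y \<in> X" if "(x, y) \<in> ?r" "x \<in> X" "X \<in> P" for x y X
    using that(1)
  proof induction
    case (step y z)
    then obtain e where e: "e \<in> edges F" "\<not> crossing (ends F) P e" "ends F e = {y, z}"
      by (auto simp: adj_def D_def)
    then have "z \<in> V" using F V by (auto simp: graph_def)
    then have "z \<in> \<Union>P" using P by (simp add: partition_on_def)
    then obtain Z where "Z \<in> P" "z \<in> Z" by auto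
    then show ?case using e(2,3) step.IH that(3) unfolding crossing_def by auto
  qed (use that in auto)
  have "\<forall>X\<in>{X \<in> P. X \<inter> verts F \<noteq> {}}. \<exists>x. x \<in> X \<inter> verts F" by auto
  then obtain g where g: "\<And>X. X \<in> P \<Longrightarrow> X \<inter> verts F \<noteq> {} \<Longrightarrow> g X \<in> X \<inter> verts F"
    by (metis (mono_tags, lifting) mem_Collect_eq)
  have "inj_on (\<lambda>X. ?r `` {g X}) {X \<in> P. X \<inter> verts F \<noteq> {}}"
  proof (rule inj_onI)
    fix X Y assume XY: "X \<in> {X \<in> P. X \<inter> verts F \<noteq> {}}" "Y \<in> {X \<in> P. X \<inter> verts F \<noteq> {}}"
      "?r `` {g X} = ?r `` {g Y}"
    then have "(g X, g Y) \<in> ?r" by auto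
    then have "g Y \<in> X" using stay g XY by blast
    then show "X = Y" using in_same_part[OF P] g XY by blast
  qed
  moreover have "(\<lambda>X. ?r `` {g X}) ` {X \<in> P. X \<inter> verts F \<noteq> {}} \<subseteq> components ?F"
    using g by (auto simp: components_def intro!: quotientI)
  moreover have "finite (components ?F)"
    using F by (simp add: components_def quotient_def graph_def)
  ultimately have "card {X \<in> P. X \<inter> verts F \<noteq> {}} \<le> num_components ?F"
    unfolding num_components_def by (rule card_inj_on_le)
  also have "\<dots> \<le> num_components F + card D"
    using F by (intro num_components_delete) (auto simp: D_def graph_def)
  finally show ?thesis by (simp add: cut_size_def D_def)
qed

lemma num_components_le: "graph F \<Longrightarrow> num_components F \<le> card (verts F)"
  unfolding num_components_def components_def quotient_def graph_def
  by (simp add: UNION_singleton_eq_range card_image_le)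

lemma cut_size_cross_edges: "cut_size (ends G) (edges G) P = cross_edges G P"
  by (simp add: cut_size_def cross_edges_def crossing_def)

lemma card_partition_le:
  assumes "finite V" "partition_on V P"
  shows "card P \<le> card V"
proof -
  have "P \<subseteq> (\<lambda>v. THE X. X \<in> P \<and> v \<in> X) ` V"
  proof
    fix X assume X: "X \<in> P"
    then have "X \<noteq> {}" using partition_onD3[OF assms(2)] by blast
    then obtain v where v: "v \<in> X" by blast
    have "(THE X. X \<in> P \<and> v \<in> X) = X"
      by (rule the_equality) (use X v in_same_part[OF assms(2)] in blast)+
    moreover have "v \<in> V" using X v assms(2) by (auto simp: partition_on_def)
    ultimately show "X \<in> (\<lambda>v. THE X. X \<in> P \<and> v \<in> X) ` V" by force
  qed
  then show ?thesis using assms(1) surj_card_le by blast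
qed

lemma packing_covers_partition:
  assumes G: "graph G" and F: "forest_packing G k F" "regular_packing h G k F"
    and P: "partition_on (verts G) P"
  shows "h * card P \<le> (\<Sum>i=1..k. min (num_components (F i)) (card P)) + cross_edges G P"
proof -
  let ?met = "\<lambda>i. {X \<in> P. X \<inter> verts (F i) \<noteq> {}}"
  let ?D = "\<lambda>i. {e \<in> edges (F i). crossing (ends (F i)) P e}"
  have V: "finite (verts G)" "finite (edges G)" using G by (auto simp: graph_def)
  have finP: "finite P" using V P finite_elements by auto
  have sub: "graph (F i)" "verts (F i) \<subseteq> verts G" "edges (F i) \<subseteq> edges G"
    "\<And>e. e \<in> edges (F i) \<Longrightarrow> ends (F i) e = ends G e" if "i \<in> {1..k}" for i
    using F(1) that by (auto simp: forest_packing_def subgraph_def)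
  have "h \<le> card {i \<in> {1..k}. X \<inter> verts (F i) \<noteq> {}}" if X: "X \<in> P" for X
  proof -
    have "X \<noteq> {}" "X \<subseteq> verts G" using X P by (auto simp: partition_on_def)
    then obtain v where v: "v \<in> X" "v \<in> verts G" by blast
    have "h = card {i \<in> {1..k}. v \<in> verts (F i)}" using F(2) v by (simp add: regular_packing_def)
    also have "\<dots> \<le> card {i \<in> {1..k}. X \<inter> verts (F i) \<noteq> {}}"
      using v by (intro card_mono) auto
    finally show ?thesis .
  qed
  then have "h * card P \<le> (\<Sum>X\<in>P. card {i \<in> {1..k}. X \<inter> verts (F i) \<noteq> {}})"
    using sum_mono[of P "\<lambda>_. h"] by (simp add: mult.commute)
  also have "\<dots> = (\<Sum>i=1..k. card (?met i))" using finP by (intro double_count) auto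
  also have "\<dots> \<le> (\<Sum>i=1..k. min (num_components (F i)) (card P) + card (?D i))"
  proof (rule sum_mono)
    fix i assume i: "i \<in> {1..k}"
    have "card (?met i) \<le> card P" using finP by (intro card_mono) auto
    moreover have "card (?met i) \<le> num_components (F i) + card (?D i)"
      using parts_met_le[OF sub(1)[OF i] P sub(2)[OF i]] by (simp add: cut_size_def)
    ultimately show "card (?met i) \<le> min (num_components (F i)) (card P) + card (?D i)" by linarith
  qed
  also have "\<dots> = (\<Sum>i=1..k. min (num_components (F i)) (card P)) + (\<Sum>i=1..k. card (?D i))"
    by (rule sum.distrib)
  also have "(\<Sum>i=1..k. card (?D i)) = card (\<Union>i\<in>{1..k}. ?D i)"
  proof (rule card_UN_disjoint[symmetric])
    show "\<forall>i\<in>{1..k}. finite (?D i)" using sub(1) by (auto simp: graph_def)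
    show "\<forall>i\<in>{1..k}. \<forall>j\<in>{1..k}. i \<noteq> j \<longrightarrow> ?D i \<inter> ?D j = {}"
      using F(1) unfolding forest_packing_def by blast
  qed simp
  also have "\<dots> \<le> cross_edges G P"
    unfolding cut_size_cross_edges[symmetric] cut_size_def
  proof (intro card_mono UN_least subsetI)
    fix i e assume i: "i \<in> {1..k}" and e: "e \<in> ?D i"
    then have "e \<in> edges G" "ends (F i) e = ends G e" using sub(3,4)[OF i] by blast+
    then show "e \<in> {e \<in> edges G. crossing (ends G) P e}" using e by (simp add: crossing_def)
  qed (use V in simp)
  finally show ?thesis by linarith
qed

section \<open>The characterisation\<close>

text \<open>
The excess of \<open>l\<close> over the truncation at \<open>p\<close> is convex in \<open>p\<close>, and \<open>h * (n - p)\<close> is linear; they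
compare correctly at \<open>p = 0\<close> and \<open>p = n\<close>, hence in between. This makes it harmless to lower the
total number of components from \<open>\<beta>\<close> to \<open>h * n\<close>.
\<close>
lemma convex_excess_le:
  fixes l :: "'a \<Rightarrow> nat"
  assumes l: "\<And>i. i \<in> K \<Longrightarrow> l i \<le> n" "sum l K \<le> h * n" and p: "p \<le> n"
  shows "sum l K + h * p \<le> h * n + (\<Sum>i\<in>K. min (l i) p)"
proof (cases "n = 0")
  case False
  have "n * sum l K \<le> n * (\<Sum>i\<in>K. min (l i) p) + (n - p) * sum l K"
    unfolding sum_distrib_left sum.distrib[symmetric]
  proof (rule sum_mono)
    fix i assume i: "i \<in> K"
    show "n * l i \<le> n * min (l i) p + (n - p) * l i"
    proof (cases "l i \<le> p")
      case False
      have "p * l i \<le> n * p" using l(1)[OF i] by (simp add: mult.commute)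
      then have "n * l i \<le> n * p + (n * l i - p * l i)" by arith
      then show ?thesis using False by (simp add: diff_mult_distrib)
    qed simp
  qed
  also have "\<dots> \<le> n * (\<Sum>i\<in>K. min (l i) p) + (n - p) * (h * n)" using l(2) by simp
  also have "(n - p) * (h * n) = n * (h * n) - n * (h * p)"
    by (simp add: diff_mult_distrib diff_mult_distrib2 ac_simps)
  moreover have "n * (h * p) \<le> n * (h * n)" using p by simp
  ultimately have "n * sum l K + n * (h * p) \<le> n * (h * n) + n * (\<Sum>i\<in>K. min (l i) p)"
    by linarith
  then have "n * (sum l K + h * p) \<le> n * (h * n + (\<Sum>i\<in>K. min (l i) p))"
    by (simp add: distrib_left)
  then show ?thesis using False by simp
qed (use assms in auto)

lemma packing_with_component_numbers:
  fixes G :: "('v, 'e) ugraph" and t :: "nat \<Rightarrow> nat"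
  assumes G: "graph G" and t: "\<And>i. i \<in> {1..k} \<Longrightarrow> 0 < t i \<and> t i \<le> card (verts G)"
    and sum: "(\<Sum>i=1..k. t i) \<le> h * card (verts G)"
    and cond: "\<And>P. partition_on (verts G) P \<Longrightarrow>
      h * card P \<le> (\<Sum>i=1..k. min (t i) (card P)) + cross_edges G P"
  shows "\<exists>F. forest_packing G k F \<and> regular_packing h G k F \<and> (\<forall>i\<in>{1..k}. num_components (F i) = t i)"
proof -
  have V: "finite (verts G)" "finite (edges G)" "\<forall>e\<in>edges G. ends G e \<subseteq> verts G"
    using G by (auto simp: graph_def)
  obtain R where R: "\<forall>v. R v \<subseteq> {1..k}" "\<forall>v\<in>verts G. card (R v) \<le> h"
    "feasible h (ends G) (verts G) (edges G) R" "\<forall>i\<in>{1..k}. card {v \<in> verts G. i \<in> R v} = t i"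
    using ex_roots[OF V finite_atLeastAtMost[of 1 k], of t h] t sum cond
    by (auto simp: cut_size_cross_edges)
  let ?T = "\<lambda>i. {v \<in> verts G. i \<in> R v}"
  have start: "forest (piece G R (\<lambda>_. {}) i) \<and> rooted (piece G R (\<lambda>_. {}) i) (?T i)" if i: "i \<in> {1..k}" for i
  proof -
    have "?T i \<noteq> {}" using R(4) t i by (metis card.empty less_irrefl)
    then have "graph (piece G R (\<lambda>_. {}) i)" using V by (simp add: piece_def graph_def)
    moreover have "\<not> is_cycle (piece G R (\<lambda>_. {}) i) vs es" for vs es
      by (auto simp: is_cycle_def piece_def)
    moreover have "rooted (piece G R (\<lambda>_. {}) i) (?T i)"
      unfolding rooted_def by (auto simp: piece_def adj_def intro!: exI[of _ id])
    ultimately show ?thesis by (simp add: forest_def)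
  qed
  obtain R' A where A: "\<forall>v. R' v \<subseteq> {1..k}" "\<forall>v\<in>verts G. card (R' v) = h"
    "\<forall>i\<in>{1..k}. A i \<subseteq> edges G" "disjoint_family_on A {1..k}"
    "\<forall>i\<in>{1..k}. forest (piece G R' A i) \<and> rooted (piece G R' A i) (?T i)"
    using grow_forests[OF G finite_atLeastAtMost[of 1 k], where R = R and h = h and E = "edges G" and A = "\<lambda>_. {}" and T = ?T]
      R start by (auto simp: disjoint_family_on_def)
  let ?F = "piece G R' A"
  have "forest_packing G k ?F"
    using A G unfolding forest_packing_def subgraph_def
    by (auto simp: forest_def piece_def disjoint_family_on_def)
  moreover have "{i \<in> {1..k}. v \<in> verts (?F i)} = R' v" if "v \<in> verts G" for v
    using A(1)[rule_format, of v] that by (auto simp: piece_def)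
  then have "regular_packing h G k ?F" using A(2) by (simp add: regular_packing_def)
  moreover have "num_components (?F i) = t i" if "i \<in> {1..k}" for i
    using num_components_rooted A(5) R(4) that by metis
  ultimately show ?thesis by blast
qed

theorem theorem15:
  fixes G :: "('v, 'e) ugraph"
    and h k \<alpha> \<beta> :: nat
    and l l' :: "nat \<Rightarrow> nat"
  assumes "graph G"
    and "h > 0" and "k > 0" and "\<alpha> > 0" and "\<beta> > 0"
    and "\<forall>i\<in>{1..k}. l i > 0 \<and> l' i > 0"
    and "(\<Sum>i=1..k. l' i) \<ge> \<beta>" and "\<beta> \<ge> \<alpha>" and "\<alpha> \<ge> (\<Sum>i=1..k. l i)"
    and "\<forall>i\<in>{1..k}. card (verts G) \<ge> l' i \<and> l' i \<ge> l i"
  shows "(\<exists>F :: nat \<Rightarrow> ('v, 'e) ugraph.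
            forest_packing G k F \<and> regular_packing h G k F \<and>
            bordered_packing l l' k F \<and> limited_packing \<alpha> \<beta> k F)
    \<longleftrightarrow>
      h * card (verts G) \<ge> \<alpha> \<and>
      (\<forall>P. partition_on (verts G) P \<longrightarrow>
         int \<beta> - (\<Sum>i=1..k. int (l i)) + (\<Sum>i=1..k. int (min (l i) (card P)))
           + int (cross_edges G P) \<ge> int (h * card P)) \<and>
      (\<forall>P. partition_on (verts G) P \<longrightarrow>
         (\<Sum>i=1..k. min (l' i) (card P)) + cross_edges G P \<ge> h * card P)"
    (is "?packing \<longleftrightarrow> ?size \<and> ?total \<and> ?upper")
proof
  assume ?packing
  then obtain F :: "nat \<Rightarrow> ('v, 'e) ugraph" where F: "forest_packing G k F" "regular_packing h G k F"
    and n: "\<And>i. i \<in> {1..k} \<Longrightarrow> l i \<le> num_components (F i) \<and> num_components (F i) \<le> l' i"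
    and lim: "\<alpha> \<le> (\<Sum>i=1..k. num_components (F i))" "(\<Sum>i=1..k. num_components (F i)) \<le> \<beta>"
    unfolding bordered_packing_def limited_packing_def by blast
  have cover: "h * card P \<le> (\<Sum>i=1..k. min (num_components (F i)) (card P)) + cross_edges G P"
    if "partition_on (verts G) P" for P
    using packing_covers_partition[OF assms(1) F that] .
  have ?size
  proof -
    have sub: "graph (F i) \<and> verts (F i) \<subseteq> verts G" if "i \<in> {1..k}" for i
      using F(1) that by (auto simp: forest_packing_def subgraph_def)
    have "(\<Sum>i=1..k. num_components (F i)) \<le> (\<Sum>i=1..k. card {v \<in> verts G. v \<in> verts (F i)})"
    proof (rule sum_mono)
      fix i assume "i \<in> {1..k}"
      then have "graph (F i)" "{v \<in> verts G. v \<in> verts (F i)} = verts (F i)" using sub by auto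
      then show "num_components (F i) \<le> card {v \<in> verts G. v \<in> verts (F i)}"
        using num_components_le by simp
    qed
    also have "\<dots> = (\<Sum>v\<in>verts G. card {i \<in> {1..k}. v \<in> verts (F i)})"
      using assms(1) by (intro double_count) (auto simp: graph_def)
    also have "\<dots> = h * card (verts G)" using F(2) by (simp add: regular_packing_def mult.commute)
    finally show ?thesis using lim(1) by linarith
  qed
  moreover have ?total
  proof (intro allI impI)
    fix P assume P: "partition_on (verts G) P"
    let ?s = "\<lambda>f. \<Sum>i=1..k. f i"
    have "?s (\<lambda>i. l i + min (num_components (F i)) (card P)) \<le> ?s (\<lambda>i. num_components (F i) + min (l i) (card P))"
    proof (rule sum_mono)
      fix i assume "i \<in> {1..k}"
      then show "l i + min (num_components (F i)) (card P) \<le> num_components (F i) + min (l i) (card P)"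
        using n[of i] by linarith
    qed
    then have "?s l + h * card P \<le> \<beta> + ?s (\<lambda>i. min (l i) (card P)) + cross_edges G P"
      using cover[OF P] lim(2) by (simp add: sum.distrib)
    then have "int (?s l + h * card P) \<le> int (\<beta> + ?s (\<lambda>i. min (l i) (card P)) + cross_edges G P)"
      by (simp only: of_nat_le_iff)
    then show "int \<beta> - (\<Sum>i=1..k. int (l i)) + (\<Sum>i=1..k. int (min (l i) (card P)))
           + int (cross_edges G P) \<ge> int (h * card P)"
      by (simp only: of_nat_add of_nat_sum)
  qed
  moreover have ?upper
  proof (intro allI impI)
    fix P assume P: "partition_on (verts G) P"
    have "(\<Sum>i=1..k. min (num_components (F i)) (card P)) \<le> (\<Sum>i=1..k. min (l' i) (card P))"
    proof (rule sum_mono)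
      fix i assume "i \<in> {1..k}"
      then show "min (num_components (F i)) (card P) \<le> min (l' i) (card P)" using n[of i] by linarith
    qed
    then show "(\<Sum>i=1..k. min (l' i) (card P)) + cross_edges G P \<ge> h * card P"
      using cover[OF P] by linarith
  qed
  ultimately show "?size \<and> ?total \<and> ?upper" by blast
next
  assume conds: "?size \<and> ?total \<and> ?upper"
  let ?n = "card (verts G)"
  define B where "B = min \<beta> (h * ?n)"
  have V: "finite (verts G)" using assms(1) by (simp add: graph_def)
  have l: "l i \<le> l' i" "l' i \<le> ?n" "0 < l i" if "i \<in> {1..k}" for i using assms that by auto
  have "sum l {1..k} \<le> B" "B \<le> sum l' {1..k}" using assms conds by (auto simp: B_def)
  then obtain t where t: "\<forall>i\<in>{1..k}. l i \<le> t i \<and> t i \<le> l' i" "sum t {1..k} = B"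
    "\<forall>i\<in>{1..k}. \<forall>j\<in>{1..k}. t j < l' j \<longrightarrow> l i < t i \<longrightarrow> t i \<le> Suc (t j)"
    using ex_balanced[of "{1..k}" l l' B] l by auto
  have "h * card P \<le> (\<Sum>i=1..k. min (t i) (card P)) + cross_edges G P"
    if P: "partition_on (verts G) P" for P
  proof -
    have "int (sum l {1..k} + h * card P) \<le> int (\<beta> + (\<Sum>i=1..k. min (l i) (card P)) + cross_edges G P)"
      using conds P by (simp only: of_nat_add of_nat_sum) force
    then have "sum l {1..k} + h * card P \<le> \<beta> + (\<Sum>i=1..k. min (l i) (card P)) + cross_edges G P"
      by (simp only: of_nat_le_iff)
    \<comment> \<open>This takes the place of the preceding estimate when \<open>B\<close> is \<open>h * ?n\<close> instead of \<open>\<beta>\<close>.\<close>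
    moreover have "sum l {1..k} + h * card P \<le> h * ?n + (\<Sum>i=1..k. min (l i) (card P))"
      using l \<open>sum l {1..k} \<le> B\<close> card_partition_le[OF V P]
      by (intro convex_excess_le) (auto simp: B_def intro: order_trans)
    moreover have "h * card P \<le> (\<Sum>i=1..k. min (l' i) (card P)) + cross_edges G P"
      using conds P by blast
    ultimately show ?thesis
      using balanced_min_sum[OF t(1,3), of "card P"] t(2) by (auto simp: B_def min_def split: if_splits)
  qed
  moreover have t_range: "0 < t i \<and> t i \<le> ?n" if "i \<in> {1..k}" for i
    using t(1) l[OF that] that by (meson less_le_trans order_trans)
  moreover have t_sum: "sum t {1..k} \<le> h * ?n" using t(2) by (simp add: B_def)
  ultimately obtain F :: "nat \<Rightarrow> ('v, 'e) ugraph" where F: "forest_packing G k F" "regular_packing h G k F"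
    "\<forall>i\<in>{1..k}. num_components (F i) = t i"
    using packing_with_component_numbers[OF assms(1), of k t h] t_range t_sum by blast
  have "(\<Sum>i=1..k. num_components (F i)) = B" using F(3) t(2) by simp
  moreover have "\<alpha> \<le> B" "B \<le> \<beta>" using conds assms by (auto simp: B_def)
  ultimately show ?packing
    using F t(1) by (intro exI[of _ F]) (simp add: bordered_packing_def limited_packing_def)
qed

end
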